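(* Let $C_1,C_2,C_3>0$. Let $\theta(t)=\mathrm{vec}(W(t),A(t),b(t))$, $t\ge 0$, be a gradient flow trajectory $\frac{d\theta}{dt}=-\frac{\partial L(\theta(t))}{\partial\theta}$ with gradients given by the formulas in the context. Let $\alpha_0:=\sigma_{\min}(Z(0))$, $\lambda_1:=\|W(0)\|+C_1$, $\lambda_2:=\|A(0)\|+C_2$, $\lambda_3:=\|b(0)\|+C_3$, and choose $\gamma>0$ such that $\gamma_0:=\gamma\lambda_2<1$. Let $\lambda_0:=\max\left\{\frac{\lambda_1}{C_3},\frac{\gamma_0\lambda_1\lambda_3}{(1-\gamma_0)C_2\lambda_2},\frac{\lambda_3}{C_1}\right\}$. Assume $$\alpha_0^2\ge\frac{4}{1-\gamma_0}\lambda_0\|X\|_F\|\hat y(0)-y\|,\qquad \alpha_0^3\ge\left[1+\frac{\gamma_0^2}{(1-\gamma_0)^2}\frac{\lambda_1^2}{\lambda_2^2}\right]\frac{8\lambda_3}{(1-\gamma_0)^2}\|X\|_F^2\|\hat y(0)-y\|.$$ Then for all $t\ge0$: (i) $\|W(t)\|\le\lambda_1$, $\|A(t)\|\le\lambda_2$, $\|b(t)\|\le\lambda_3$; (ii) $\sigma_{\min}(Z(t))\ge\alpha_0/2$; (iii) $L(\theta(t))\le\exp\{-\alpha_0^2t/2\}L(\theta(0))$.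
   Context: Data $X\in\mathbb{R}^{N\times d}$, $y\in\mathbb{R}^N$; parameters $W\in\mathbb{R}^{d\times m}$, $A\in\mathbb{R}^{m\times m}$, $b\in\mathbb{R}^m$. $\sigma(u)=\max\{0,u\}$ entrywise, $\sigma'(u)=\mathbf 1\{u>0\}$ entrywise. $\Phi=\sigma(XW)$; $Z$ is the unique solution of $Z=\sigma(\gamma ZA+\Phi)$ (exists when $\gamma\|A\|<1$); $\hat y=Zb$; $L(\theta)=\frac12\|\hat y-y\|^2$. $D:=\mathrm{diag}[\mathrm{vec}(\sigma'(\gamma ZA+\Phi))]$, $E:=\mathrm{diag}[\mathrm{vec}(\sigma'(XW))]$, $Q:=I_{Nm}-\gamma D(A^T\otimes I_N)$. Gradients: $\frac{\partial L}{\partial W}=[DE(I_m\otimes X)]^TQ^{-T}(b^T\otimes I_N)^T(\hat y-y)$, $\frac{\partial L}{\partial A}=\gamma[D(I_m\otimes Z)]^TQ^{-T}(b^T\otimes I_N)^T(\hat y-y)$, $\frac{\partial L}{\partial b}=Z^T(\hat y-y)$ (gradients w.r.t. $\mathrm{vec}(W)$, $\mathrm{vec}(A)$, $b$). $\|\cdot\|$ is the spectral norm (Euclidean norm for vectors), $\|\cdot\|_F$ the Frobenius norm, $\sigma_{\min}(Z)=\sqrt{\lambda_{\min}(ZZ^T)}$ for $Z\in\mathbb{R}^{N\times m}$. *)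

theory Defs
  imports "HOL-Analysis.Analysis"
begin

text \<open>Matrices are real^'cols^'rows: an N x d matrix is real^'d^'N.
  vec stacks columns; the vec-index of entry (row k, column j) is the pair (j,k).\<close>

definition relu_mat :: "real^'n^'m \<Rightarrow> real^'n^'m" where
  "relu_mat M = (\<chi> i j. max 0 (M $ i $ j))"

definition vecm :: "real^'n^'r \<Rightarrow> real^('n \<times> 'r)" where
  "vecm M = (\<chi> p. M $ snd p $ fst p)"

definition kron :: "real^'q^'p \<Rightarrow> real^'s^'r \<Rightarrow> real^('q \<times> 's)^('p \<times> 'r)" where
  "kron P Q = (\<chi> r c. P $ fst r $ fst c * Q $ snd r $ snd c)"

text \<open>b^T \<otimes> I_N, the leading singleton row dimension of b^T dropped.\<close>
definition rowkron_id :: "real^'m \<Rightarrow> real^('m \<times> 'N)^'N" where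
  "rowkron_id b = (\<chi> i c. b $ fst c * (if snd c = i then 1 else 0))"

definition diagm :: "real^'a \<Rightarrow> real^'a^'a" where
  "diagm v = (\<chi> i j. if i = j then v $ i else 0)"

definition Phi :: "real^'d^'N \<Rightarrow> real^'m^'d \<Rightarrow> real^'m^'N" where
  "Phi X W = relu_mat (X ** W)"

definition Zeq :: "real \<Rightarrow> real^'d^'N \<Rightarrow> real^'m^'d \<Rightarrow> real^'m^'m \<Rightarrow> real^'m^'N" where
  "Zeq \<gamma> X W A = (THE Z. Z = relu_mat (\<gamma> *\<^sub>R (Z ** A) + Phi X W))"

definition yhat :: "real \<Rightarrow> real^'d^'N \<Rightarrow> real^'m^'d \<Rightarrow> real^'m^'m \<Rightarrow> real^'m \<Rightarrow> real^'N" where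
  "yhat \<gamma> X W A b = Zeq \<gamma> X W A *v b"

definition loss :: "real \<Rightarrow> real^'d^'N \<Rightarrow> real^'N \<Rightarrow> real^'m^'d \<Rightarrow> real^'m^'m \<Rightarrow> real^'m \<Rightarrow> real" where
  "loss \<gamma> X y W A b = (1/2) * (norm (yhat \<gamma> X W A b - y))\<^sup>2"

definition Dmat :: "real \<Rightarrow> real^'d^'N \<Rightarrow> real^'m^'d \<Rightarrow> real^'m^'m \<Rightarrow> real^('m \<times> 'N)^('m \<times> 'N)" where
  "Dmat \<gamma> X W A = diagm (vecm (\<chi> i j.
      if (\<gamma> *\<^sub>R (Zeq \<gamma> X W A ** A) + Phi X W) $ i $ j > 0 then 1 else 0))"

definition Emat :: "real^'d^'N \<Rightarrow> real^'m^'d \<Rightarrow> real^('m \<times> 'N)^('m \<times> 'N)" where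
  "Emat X W = diagm (vecm (\<chi> i j. if (X ** W) $ i $ j > 0 then 1 else 0))"

definition Qmat :: "real \<Rightarrow> real^'d^'N \<Rightarrow> real^'m^'d \<Rightarrow> real^'m^'m \<Rightarrow> real^('m \<times> 'N)^('m \<times> 'N)" where
  "Qmat \<gamma> X W A = mat 1 - \<gamma> *\<^sub>R (Dmat \<gamma> X W A ** kron (transpose A) (mat 1 :: real^'N^'N))"

definition back_vec :: "real \<Rightarrow> real^'d^'N \<Rightarrow> real^'N \<Rightarrow> real^'m^'d \<Rightarrow> real^'m^'m \<Rightarrow> real^'m \<Rightarrow> real^('m \<times> 'N)" where
  "back_vec \<gamma> X y W A b = transpose (matrix_inv (Qmat \<gamma> X W A))
      *v (transpose (rowkron_id b :: real^('m \<times> 'N)^'N) *v (yhat \<gamma> X W A b - y))"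

definition gradW :: "real \<Rightarrow> real^'d^'N \<Rightarrow> real^'N \<Rightarrow> real^'m^'d \<Rightarrow> real^'m^'m \<Rightarrow> real^'m \<Rightarrow> real^('m \<times> 'd)" where
  "gradW \<gamma> X y W A b = transpose (Dmat \<gamma> X W A ** Emat X W ** kron (mat 1 :: real^'m^'m) X)
      *v back_vec \<gamma> X y W A b"

definition gradA :: "real \<Rightarrow> real^'d^'N \<Rightarrow> real^'N \<Rightarrow> real^'m^'d \<Rightarrow> real^'m^'m \<Rightarrow> real^'m \<Rightarrow> real^('m \<times> 'm)" where
  "gradA \<gamma> X y W A b = \<gamma> *\<^sub>R (transpose (Dmat \<gamma> X W A ** kron (mat 1 :: real^'m^'m) (Zeq \<gamma> X W A))
      *v back_vec \<gamma> X y W A b)"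

definition gradb :: "real \<Rightarrow> real^'d^'N \<Rightarrow> real^'N \<Rightarrow> real^'m^'d \<Rightarrow> real^'m^'m \<Rightarrow> real^'m \<Rightarrow> real^'m" where
  "gradb \<gamma> X y W A b = transpose (Zeq \<gamma> X W A) *v (yhat \<gamma> X W A b - y)"

definition spec_norm :: "real^'n^'m \<Rightarrow> real" where
  "spec_norm M = onorm (\<lambda>x. M *v x)"

definition frob_norm :: "real^'n^'m \<Rightarrow> real" where
  "frob_norm M = sqrt (\<Sum>i\<in>UNIV. \<Sum>j\<in>UNIV. (M $ i $ j)\<^sup>2)"

definition lambda_min :: "real^'n^'n \<Rightarrow> real" where
  "lambda_min M = Min {l. \<exists>v. v \<noteq> 0 \<and> M *v v = l *\<^sub>R v}"

definition sigma_min :: "real^'m^'N \<Rightarrow> real" where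
  "sigma_min Z = sqrt (lambda_min (Z ** transpose Z))"

end

theory Submission
  imports Defs
begin

text \<open>As long as \<open>W, A, b\<close> stay within distance \<open>C\<^sub>1, C\<^sub>2, C\<^sub>3\<close> of their initial values and
  \<open>Z\<close> within \<open>\<alpha>\<^sub>0 / 2\<close> of its own, \<open>\<sigma>\<^sub>m\<^sub>i\<^sub>n(Z) \<ge> \<alpha>\<^sub>0 / 2\<close> and the \<open>b\<close>-gradient \<open>Z\<^sup>T(Zb - y)\<close> alone
  forces the loss to decay at rate \<open>\<alpha>\<^sub>0\<^sup>2 / 2\<close>. The gradients are bounded by the residual, so they are
  integrable in time and the two assumptions on \<open>\<alpha>\<^sub>0\<close> say exactly that the total displacement stays
  within the budget, strictly at finite times; hence the trajectory never leaves the region.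

  Since \<open>\<sigma>\<close> is not differentiable at \<open>0\<close>, the loss need not be differentiable along the trajectory.
  The equilibrium \<open>Z\<close> however always has a right derivative, and this derivative agrees with the
  convention \<open>\<sigma>'(0) = 0\<close> unless some pre-activation leaves \<open>0\<close> immediately. Such times are isolated
  from the right in a zero set, hence countable, and a continuous function whose right derivative is
  nonpositive outside a countable set is decreasing.\<close>

section \<open>Real analysis\<close>

text \<open>A point \<open>t\<close> of \<open>S\<close> that is isolated from the right has a gap
  \<open>{t<..<e t}\<close> free of \<open>S\<close>. Any later point of \<open>S\<close> lies at or
  beyond \<open>e t\<close>, so the gaps are pairwise disjoint nonempty open sets, of which the real
  line holds only countably many.\<close>

lemma countable_isolated_from_right:
  fixes S :: "real set"
  shows "countable {t\<in>S. \<not> (\<exists>\<^sub>F s in at_right t. s \<in> S)}" (is "countable ?I")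
proof -
  have "\<forall>t\<in>?I. \<exists>e>t. \<forall>s. t < s \<longrightarrow> s < e \<longrightarrow> s \<notin> S"
    by (auto simp: not_frequently eventually_at_right_field)
  from bchoice[OF this] obtain e where "\<forall>t\<in>?I. e t > t \<and> (\<forall>s. t < s \<longrightarrow> s < e t \<longrightarrow> s \<notin> S)"
    by blast
  then have e: "\<And>t. t \<in> ?I \<Longrightarrow> e t > t"
    "\<And>t s. t \<in> ?I \<Longrightarrow> t < s \<Longrightarrow> s < e t \<Longrightarrow> s \<notin> S" by blast+
  define G where "G t = {t<..<e t}" for t
  have dis: "disjnt (G t) (G t')" if "t \<in> ?I" "t' \<in> ?I" "t < t'" for t t'
  proof -
    have "t' \<in> S" using that(2) by blast
    then have "e t \<le> t'" using e(2)[OF that(1,3)] by (meson not_le)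
    then show ?thesis by (auto simp: disjnt_def G_def)
  qed
  have ne: "G t \<noteq> {}" if "t \<in> ?I" for t
    using e(1)[OF that] by (simp add: G_def)
  have dis': "disjnt (G t) (G t')" if "t \<in> ?I" "t' \<in> ?I" "t \<noteq> t'" for t t'
    using dis[OF that(1,2)] dis[OF that(2,1)] that(3) disjnt_sym by (cases "t < t'") auto
  have inj: "inj_on G ?I"
  proof (rule inj_onI, rule ccontr)
    fix t t' assume t: "t \<in> ?I" "t' \<in> ?I" "G t = G t'" "t \<noteq> t'"
    then have "disjnt (G t) (G t)" using dis'[OF t(1,2,4)] by (simp only:)
    then show False using ne[OF t(1)] by (simp only: disjnt_self_iff_empty)
  qed
  have "pairwise disjnt (G ` ?I)"
  proof (rule pairwiseI)
    fix U V assume "U \<in> G ` ?I" "V \<in> G ` ?I" "U \<noteq> V"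
    then obtain t t' where t: "t \<in> ?I" "t' \<in> ?I" and UV: "U = G t" "V = G t'" by blast
    with \<open>U \<noteq> V\<close> have "t \<noteq> t'" by blast
    then show "disjnt U V" unfolding UV by (rule dis'[OF t])
  qed
  then have "countable (G ` ?I)"
    by (rule countable_disjoint_open_subsets[rotated]) (auto simp: G_def)
  with inj show ?thesis using countable_image_inj_on by blast
qed

text \<open>Zygmund's argument: if \<open>g\<close> grew from a nonpositive to a positive value, then for every
  intermediate level \<open>c\<close> the last time at which \<open>g\<close> is at most \<open>c\<close> would be an
  exceptional time, and these times are different for different levels.\<close>

lemma right_derivative_nonpos_imp_le:
  fixes f f' :: "real \<Rightarrow> real"
  assumes ab: "a \<le> b" and cont: "continuous_on {a..b} f" and S: "countable S"
    and der: "\<And>t. a \<le> t \<Longrightarrow> t < b \<Longrightarrow> t \<notin> S \<Longrightarrow> (f has_vector_derivative f' t) (at_right t)"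
    and neg: "\<And>t. a \<le> t \<Longrightarrow> t < b \<Longrightarrow> t \<notin> S \<Longrightarrow> f' t \<le> 0"
  shows "f b \<le> f a"
proof (rule ccontr)
  assume "\<not> f b \<le> f a"
  then have gt: "f b > f a" by simp
  then have "a < b" using ab by (cases "a = b") auto
  \<comment> \<open>Half the mean slope of \<open>f\<close>: subtracting it leaves
    \<open>g b > 0\<close>, yet makes the right derivative of \<open>g\<close> strictly negative
    outside \<open>S\<close>.\<close>
  define \<epsilon> where "\<epsilon> = (f b - f a) / (b - a) / 2"
  have \<epsilon>: "\<epsilon> > 0" unfolding \<epsilon>_def using gt \<open>a < b\<close> by simp
  define g where "g t = f t - f a - \<epsilon> * (t - a)" for t
  have ga: "g a = 0" by (simp add: g_def)
  have "\<epsilon> * (b - a) = (f b - f a) / 2"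
    unfolding \<epsilon>_def using nonzero_eq_divide_eq[of "b - a" "(f b - f a) / (b - a)" "f b - f a"] \<open>a < b\<close>
    by (simp only: times_divide_eq_left) simp
  then have gb: "g b > 0" unfolding g_def using gt by simp
  have gcont: "continuous_on {a..b} g"
    unfolding g_def by (intro continuous_intros cont)
  have ex: "\<exists>t. a \<le> t \<and> t < b \<and> t \<in> S \<and> g t = c" if c: "0 < c" "c < g b" for c
  proof -
    define K where "K = {t\<in>{a..b}. g t \<in> {..c}}"
    have "closedin (top_of_set {a..b}) K"
      using continuous_closedin_preimage[OF gcont, of "{..c}"]
      by (simp add: K_def vimage_def Int_def)
    then have "compact K" using closedin_compact_eq by (metis compact_Icc closedin_compact)
    moreover have "a \<in> K" unfolding K_def using ab ga c by simp
    ultimately obtain t where t: "t \<in> K" "\<And>s. s \<in> K \<Longrightarrow> s \<le> t"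
      using compact_attains_sup[of K] by blast
    have tb: "a \<le> t" "t < b" "g t \<le> c" using t(1) c unfolding K_def
      by (auto simp: order_le_less)
    have above: "g s > c" if "t < s" "s \<le> b" for s
      using t(2)[of s] that tb unfolding K_def by force
    have "g t = c"
    proof (rule ccontr)
      assume "g t \<noteq> c"
      then have "g t < c" using tb by simp
      have "(g \<longlongrightarrow> g t) (at t within {t..b})"
        using continuous_on_subset[OF gcont, of "{t..b}"] tb by (auto simp: continuous_on_def)
      from order_tendstoD(2)[OF this \<open>g t < c\<close>] have "eventually (\<lambda>s. g s < c) (at t within {t..b})" .
      then have "eventually (\<lambda>s. g s < c) (at_right t)"
        using tb by (simp add: at_within_Icc_at_right)
      then obtain e where "e > t" "\<And>s. t < s \<Longrightarrow> s < e \<Longrightarrow> g s < c"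
        by (auto simp: eventually_at_right_field)
      then have "g ((t + min e b) / 2) < c" using tb by (auto simp: min_def)
      moreover have "g ((t + min e b) / 2) > c" using tb \<open>e > t\<close> by (intro above) (auto simp: min_def)
      ultimately show False by simp
    qed
    moreover have "t \<in> S"
    proof (rule ccontr)
      assume "t \<notin> S"
      then have d: "(f has_vector_derivative f' t) (at_right t)" "f' t \<le> 0"
        using der neg tb by auto
      have "(g has_vector_derivative (f' t - \<epsilon>)) (at_right t)"
        unfolding g_def by (auto intro!: derivative_eq_intros d(1))
      then have "(g has_real_derivative (f' t - \<epsilon>)) (at_right t)"
        by (simp add: has_real_derivative_iff_has_vector_derivative)
      then have lim: "((\<lambda>s. (g s - g t) / (s - t)) \<longlongrightarrow> f' t - \<epsilon>) (at_right t)"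
        by (simp add: has_field_derivative_iff)
      \<comment> \<open>To the right of \<open>t\<close> the function stays above its value
        \<open>c = g t\<close>, so the difference quotients are nonnegative, against the limit
        \<open>f' t - \<epsilon> < 0\<close>.\<close>
      have "eventually (\<lambda>s. (g s - g t) / (s - t) \<ge> 0) (at_right t)"
        unfolding eventually_at_right_field
        using above tb \<open>g t = c\<close> by (intro exI[of _ b]) (auto intro!: divide_nonneg_pos less_imp_le)
      with lim have "f' t - \<epsilon> \<ge> 0"
        by (rule tendsto_lowerbound) simp
      then show False using d \<epsilon> by simp
    qed
    ultimately show ?thesis using tb by blast
  qed
  have "{0<..<g b} \<subseteq> g ` S" using ex by force
  then have "countable {0<..<g b}" using S countable_subset countable_image by metis
  then show False using gb uncountable_open_interval by blast
qed

text \<open>Real induction: the infimum of the times violating \<open>P\<close> satisfies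
  \<open>P\<close> by \<open>reach\<close>, and \<open>extend\<close> then pushes all violations a
  positive distance away from it. The base case is \<open>reach\<close> at \<open>T = 0\<close>,
  where the premise about earlier times is vacuous.\<close>

lemma continuous_induction_nonneg:
  fixes P :: "real \<Rightarrow> bool"
  assumes reach: "\<And>T. T \<ge> 0 \<Longrightarrow> (\<And>s. 0 \<le> s \<Longrightarrow> s < T \<Longrightarrow> P s) \<Longrightarrow> P T"
    and extend: "\<And>T. T \<ge> 0 \<Longrightarrow> P T \<Longrightarrow> eventually P (at_right T)"
    and "t \<ge> 0"
  shows "P t"
proof (rule ccontr)
  assume "\<not> P t"
  define B where "B = {t. t \<ge> 0 \<and> \<not> P t}"
  have B: "B \<noteq> {}" "bdd_below B" using \<open>\<not> P t\<close> \<open>t \<ge> 0\<close> unfolding B_def by (auto intro!: bdd_belowI[of _ 0])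
  define T where "T = Inf B"
  have "T \<ge> 0" unfolding T_def using B by (intro cInf_greatest) (auto simp: B_def)
  have before: "P s" if "0 \<le> s" "s < T" for s
    using cInf_lower[of s B] B that unfolding T_def B_def by force
  have PT: "P T" using reach \<open>T \<ge> 0\<close> before by blast
  then obtain e where e: "e > T" "\<And>s. T < s \<Longrightarrow> s < e \<Longrightarrow> P s"
    using extend[OF \<open>T \<ge> 0\<close>] by (auto simp: eventually_at_right_field)
  have "s \<ge> e" if "s \<in> B" for s
    using that before[of s] PT e(2)[of s] unfolding B_def by force
  then have "T \<ge> e" unfolding T_def using B by (intro cInf_greatest) auto
  then show False using e by simp
qed

section \<open>Matrix norms\<close>

lemma norm_vec_mono:
  fixes x :: "'a::real_normed_vector^'n" and y :: "'b::real_normed_vector^'n"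
  assumes "\<And>i. norm (x $ i) \<le> norm (y $ i)"
  shows "norm x \<le> norm y"
  unfolding norm_vec_def by (intro L2_set_mono) (use assms in auto)

lemma norm_vec_le_mult:
  fixes x :: "'a::real_normed_vector^'n" and y :: "'b::real_normed_vector^'n"
  assumes "\<And>i. norm (x $ i) \<le> c * norm (y $ i)" "c \<ge> 0"
  shows "norm x \<le> c * norm y"
proof -
  have "norm x \<le> norm (c *\<^sub>R y)"
    by (rule norm_vec_mono) (use assms in simp)
  then show ?thesis using assms by simp
qed

lemma frob_norm_eq_norm: "frob_norm M = norm M"
  unfolding frob_norm_def norm_vec_def L2_set_def
  by (simp add: sum_nonneg)

lemma norm_matrix_vector_mult_le: "norm (M *v x) \<le> norm M * norm x" for M :: "real^'n^'m"
proof -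
  have "norm (M *v x) \<le> norm x * norm M"
    proof (rule norm_vec_le_mult)
    show "norm ((M *v x) $ i) \<le> norm x * norm (M $ i)" for i
      using Cauchy_Schwarz_ineq2[of "M $ i" x] by (simp add: matrix_mult_dot mult.commute)
  qed simp
  then show ?thesis by (simp add: mult.commute)
qed

lemma norm_le_spec_norm: "norm (M *v x) \<le> spec_norm M * norm x" for M :: "real^'n^'m"
  unfolding spec_norm_def by (rule onorm) simp

lemma spec_norm_le: "(\<And>x. norm (M *v x) \<le> c * norm x) \<Longrightarrow> spec_norm M \<le> c"
  unfolding spec_norm_def by (rule onorm_le)

lemma spec_norm_nonneg: "0 \<le> spec_norm M" for M :: "real^'n^'m"
  unfolding spec_norm_def by (rule onorm_pos_le) simp

lemma spec_norm_le_norm: "spec_norm M \<le> norm M" for M :: "real^'n^'m"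
  by (rule spec_norm_le) (rule norm_matrix_vector_mult_le)

lemma spec_norm_diff_le: "spec_norm M \<le> spec_norm N + norm (M - N)" for M :: "real^'n^'m"
proof (rule spec_norm_le)
  fix x
  have "M *v x = N *v x + (M - N) *v x" by (simp add: matrix_vector_mult_diff_rdistrib)
  then have "norm (M *v x) \<le> norm (N *v x) + norm ((M - N) *v x)" by (simp add: norm_triangle_ineq)
  also have "\<dots> \<le> spec_norm N * norm x + norm (M - N) * norm x"
    by (intro add_mono norm_le_spec_norm norm_matrix_vector_mult_le)
  finally show "norm (M *v x) \<le> (spec_norm N + norm (M - N)) * norm x" by (simp add: algebra_simps)
qed

lemma inner_transpose_matrix_vector: "(transpose M *v x) \<bullet> y = x \<bullet> (M *v y)" for M :: "real^'n^'m"
  by (metis dot_lmul_matrix vector_transpose_matrix transpose_transpose)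

text \<open>The squared norm of \<open>transpose M *v x\<close> is the inner product of
  \<open>x\<close> with \<open>M *v (transpose M *v x)\<close>, and one factor cancels. The
  gradients are transposed operators, so their bounds can be read off from the untransposed
  ones.\<close>

lemma norm_transpose_mult_le:
  fixes M :: "real^'n^'m"
  assumes "\<And>x. norm (M *v x) \<le> c * norm x"
  shows "norm (transpose M *v x) \<le> c * norm x"
proof (cases "transpose M *v x = 0")
  case True
  have "c * norm x \<ge> 0" if "c \<ge> 0" using that by simp
  \<comment> \<open>Testing the hypothesis on a unit vector gives the sign of \<open>c\<close>;
    nothing can be cancelled in this case.\<close>
  moreover have "c \<ge> 0"
    using assms[of "axis undefined 1"] norm_ge_zero[of "M *v axis undefined 1"]
    by (metis order_trans mult.right_neutral norm_axis_1)
  ultimately show ?thesis using True by simp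
next
  case False
  let ?y = "transpose M *v x"
  have "norm ?y * norm ?y = x \<bullet> (M *v ?y)"
    by (metis inner_transpose_matrix_vector power2_eq_square power2_norm_eq_inner)
  also have "\<dots> \<le> norm x * norm (M *v ?y)" by (rule norm_cauchy_schwarz)
  also have "\<dots> \<le> norm x * (c * norm ?y)" by (intro mult_left_mono assms) auto
  finally show ?thesis using False by (simp add: algebra_simps)
qed

lemma norm_vector_matrix_le: "norm (x v* M) \<le> spec_norm M * norm x" for M :: "real^'n^'m"
  using norm_transpose_mult_le[of M, OF norm_le_spec_norm] by simp

lemma matrix_mult_row: "(A ** B) $ i = (A $ i) v* B"
  by (simp add: vec_eq_iff matrix_matrix_mult_def vector_matrix_mult_def mult.commute)

text \<open>The rows of \<open>A ** B\<close> are the rows of \<open>A\<close> multiplied by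
  \<open>B\<close>, so the estimate holds row by row. Keeping the spectral norm on the right factor
  turns \<gamma> times the spectral norm of the weight matrix into a contraction factor for the
  Frobenius norm.\<close>

lemma norm_matrix_mult_spec: "norm (A ** B) \<le> norm A * spec_norm B"
  for A :: "real^'n^'m" and B :: "real^'k^'n"
proof -
  have "norm (A ** B) \<le> spec_norm B * norm A"
    by (rule norm_vec_le_mult) (simp_all add: matrix_mult_row norm_vector_matrix_le spec_norm_nonneg)
  then show ?thesis by (simp add: mult.commute)
qed

lemma norm_matrix_mult_le: "norm (A ** B) \<le> norm A * norm B"
  for A :: "real^'n^'m" and B :: "real^'k^'n"
  using norm_matrix_mult_spec[of A B] mult_left_mono[OF spec_norm_le_norm[of B], of "norm A"] by simp

lemma bounded_bilinear_matrix_mult: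
  "bounded_bilinear (\<lambda>(A :: real^'n^'m) (B :: real^'k^'n). A ** B)"
proof
  show "\<exists>K. \<forall>(A :: real^'n^'m) (B :: real^'k^'n). norm (A ** B) \<le> norm A * norm B * K"
    using norm_matrix_mult_le by (intro exI[of _ 1]) auto
qed (simp_all add: vec_eq_iff matrix_matrix_mult_def algebra_simps sum.distrib sum_distrib_left)

lemma bounded_bilinear_matrix_vector_mult:
  "bounded_bilinear (\<lambda>(A :: real^'n^'m) x. A *v x)"
proof
  show "\<exists>K. \<forall>(A :: real^'n^'m) x. norm (A *v x) \<le> norm A * norm x * K"
    using norm_matrix_vector_mult_le by (intro exI[of _ 1]) auto
qed (simp_all add: vec_eq_iff matrix_vector_mult_def algebra_simps sum.distrib sum_distrib_left)

section \<open>The smallest singular value\<close>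

lemma norm_transpose_squared: "(norm (transpose Z *v v))\<^sup>2 = v \<bullet> ((Z ** transpose Z) *v v)"
  for Z :: "real^'m^'n"
  by (metis inner_transpose_matrix_vector matrix_vector_mul_assoc power2_norm_eq_inner)

lemma inner_gram_symmetric:
  "((Z ** transpose Z) *v v) \<bullet> w = v \<bullet> ((Z ** transpose Z) *v w)" for Z :: "real^'m^'n"
  by (metis inner_transpose_matrix_vector matrix_transpose_mul transpose_transpose)

text \<open>Eigenvectors of a symmetric matrix for distinct eigenvalues are orthogonal, hence
  independent. Finiteness is what gives the \<open>Min\<close> in \<open>lambda_min\<close> its
  meaning.\<close>

lemma finite_eigenvalues_gram:
  fixes Z :: "real^'m^'n"
  shows "finite {l. \<exists>v. v \<noteq> 0 \<and> (Z ** transpose Z) *v v = l *\<^sub>R v}" (is "finite ?E")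
proof -
  have "\<forall>l\<in>?E. \<exists>v. v \<noteq> 0 \<and> (Z ** transpose Z) *v v = l *\<^sub>R v" by blast
  from bchoice[OF this] obtain v
    where "\<forall>l\<in>?E. v l \<noteq> 0 \<and> (Z ** transpose Z) *v v l = l *\<^sub>R v l" by blast
  then have v: "v l \<noteq> 0" "(Z ** transpose Z) *v v l = l *\<^sub>R v l" if "l \<in> ?E" for l
    using that by blast+
  have orth: "v l \<bullet> v l' = 0" if "l \<in> ?E" "l' \<in> ?E" "l \<noteq> l'" for l l'
  proof -
    have "l * (v l \<bullet> v l') = l' * (v l \<bullet> v l')"
      using inner_gram_symmetric[of Z "v l" "v l'"] v(2)[OF that(1)] v(2)[OF that(2)] by simp
    with that show ?thesis by simp
  qed
  have inj: "inj_on v ?E"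
  proof (rule inj_onI, rule ccontr)
    fix l l' assume l: "l \<in> ?E" "l' \<in> ?E" "v l = v l'" "l \<noteq> l'"
    have "v l \<bullet> v l = 0" using orth[OF l(1,2,4)] l(3) by (simp only:)
    then show False using v(1)[OF l(1)] by (simp only: inner_eq_zero_iff)
  qed
  have "pairwise orthogonal (v ` ?E)"
  proof (rule pairwiseI)
    fix u w assume "u \<in> v ` ?E" "w \<in> v ` ?E" "u \<noteq> w"
    then obtain l l' where l: "l \<in> ?E" "l' \<in> ?E" and uw: "u = v l" "w = v l'" by blast
    with \<open>u \<noteq> w\<close> have "l \<noteq> l'" by blast
    then show "orthogonal u w" unfolding uw orthogonal_def by (rule orth[OF l])
  qed
  moreover have "0 \<notin> v ` ?E"
  proof
    assume "0 \<in> v ` ?E"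
    then obtain l where "l \<in> ?E" "0 = v l" by blast
    with v(1)[of l] show False by simp
  qed
  ultimately have "independent (v ` ?E)" using pairwise_orthogonal_independent by blast
  then have "finite (v ` ?E)" by (rule independent_imp_finite)
  with inj show ?thesis using finite_image_iff by blast
qed

text \<open>A unit vector minimizing the norm of \<open>transpose Z *v v\<close> exists by
  compactness and turns out to be an eigenvector of the Gram matrix for its smallest eigenvalue.
  This replaces the eigenvalue definition by one suited to estimates.\<close>

lemma sigma_min_variational:
  fixes Z :: "real^'m^'n"
  shows "\<exists>v. norm v = 1 \<and> norm (transpose Z *v v) = sigma_min Z
    \<and> (\<forall>w. sigma_min Z * norm w \<le> norm (transpose Z *v w))"
proof -
  let ?S = "Z ** transpose Z"
  have "continuous_on (sphere 0 1) (\<lambda>v::real^'n. norm (transpose Z *v v))"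
    by (intro continuous_intros)
  moreover have "sphere 0 1 \<noteq> ({} :: (real^'n) set)" by simp
  ultimately obtain v where v: "norm v = 1"
      "\<And>w. norm w = 1 \<Longrightarrow> norm (transpose Z *v v) \<le> norm (transpose Z *v w)"
    using continuous_attains_inf[OF compact_sphere, of 0 1 "\<lambda>v::real^'n. norm (transpose Z *v v)"]
    by auto
  let ?s = "norm (transpose Z *v v)"
  have low: "?s * norm w \<le> norm (transpose Z *v w)" for w
  proof (cases "w = 0")
    case False
    have "transpose Z *v (w /\<^sub>R norm w) = (transpose Z *v w) /\<^sub>R norm w"
      by (rule matrix_vector_mult_scaleR)
    then have "?s \<le> norm ((transpose Z *v w) /\<^sub>R norm w)" using v(2)[of "w /\<^sub>R norm w"] False by simp
    then show ?thesis using False by (simp add: field_simps)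
  qed simp
  \<comment> \<open>\<open>B\<close> is positive semidefinite by minimality and its quadratic form
    vanishes at \<open>v\<close>. Perturbing \<open>v\<close> in the direction \<open>B v\<close>
    shows that this forces \<open>B v = 0\<close>.\<close>
  define B where "B w = ?S *v w - ?s\<^sup>2 *\<^sub>R w" for w
  have Bsym: "B u \<bullet> w = u \<bullet> B w" for u w
    by (simp add: B_def inner_diff_left inner_diff_right inner_gram_symmetric)
  have Bpos: "w \<bullet> B w \<ge> 0" for w
  proof -
    have "(?s * norm w)\<^sup>2 \<le> (norm (transpose Z *v w))\<^sup>2" by (intro power_mono low) simp
    then show ?thesis unfolding B_def norm_transpose_squared[of Z w]
      by (simp add: inner_diff_right power_mult_distrib dot_square_norm)
  qed
  have Bv: "v \<bullet> B v = 0"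
    using v(1) unfolding B_def norm_transpose_squared[of Z v]
    by (simp add: inner_diff_right dot_square_norm)
  have "B v = 0"
  proof (rule ccontr)
    assume "B v \<noteq> 0"
    define p where "p = (norm (B v))\<^sup>2"
    define q where "q = B v \<bullet> B (B v)"
    have p: "p > 0" unfolding p_def using \<open>B v \<noteq> 0\<close> by simp
    have q: "q \<ge> 0" unfolding q_def by (rule Bpos)
    have lin: "B (v + s *\<^sub>R w) = B v + s *\<^sub>R B w" for s w
      by (simp add: B_def matrix_vector_right_distrib matrix_vector_mult_scaleR algebra_simps)
    have expand: "2 * s * p + s\<^sup>2 * q \<ge> 0" for s
    proof -
      have "(v + s *\<^sub>R B v) \<bullet> B (v + s *\<^sub>R B v) = v \<bullet> B v + s * (v \<bullet> B (B v)) + s * (B v \<bullet> B v) + s\<^sup>2 * q"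
        by (simp add: lin inner_add_left inner_add_right q_def power2_eq_square algebra_simps)
      also have "v \<bullet> B (B v) = p" by (simp add: Bsym[symmetric] p_def dot_square_norm)
      also have "B v \<bullet> B v = p" by (simp add: p_def dot_square_norm)
      finally show ?thesis using Bpos[of "v + s *\<^sub>R B v"] Bv by (simp add: mult.commute mult.left_commute)
    qed
    \<comment> \<open>At \<open>s = - t\<close> the quadratic in \<open>expand\<close> takes the
      value \<open>t * (- t - p) < 0\<close>; the \<open>+ 1\<close> covers
      \<open>q = 0\<close>.\<close>
    define t where "t = p / (q + 1)"
    have t: "t > 0" unfolding t_def using p q by simp
    have "t * q + t = p" unfolding t_def using q by (simp add: field_simps add_nonneg_eq_0_iff)
    then have tq: "t * q = p - t" by simp
    have "2 * (- t) * p + (- t)\<^sup>2 * q = t * (t * q) - 2 * (t * p)" by (simp add: power2_eq_square)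
    also have "\<dots> = t * (- t - p)" unfolding tq by (simp add: right_diff_distrib)
    also have "\<dots> < 0" using t p by (intro mult_pos_neg) auto
    finally have "2 * (- t) * p + (- t)\<^sup>2 * q < 0" .
    with expand[of "- t"] show False by simp
  qed
  then have ev: "?S *v v = ?s\<^sup>2 *\<^sub>R v" by (simp add: B_def)
  have "Min {l. \<exists>v. v \<noteq> 0 \<and> ?S *v v = l *\<^sub>R v} = ?s\<^sup>2"
  proof (rule Min_eqI[OF finite_eigenvalues_gram])
    show "?s\<^sup>2 \<in> {l. \<exists>v. v \<noteq> 0 \<and> ?S *v v = l *\<^sub>R v}" using ev v(1) by (metis (mono_tags, lifting) mem_Collect_eq norm_zero zero_neq_one)
  next
    fix l assume "l \<in> {l. \<exists>v. v \<noteq> 0 \<and> ?S *v v = l *\<^sub>R v}"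
    then obtain w where w: "w \<noteq> 0" "?S *v w = l *\<^sub>R w" by blast
    have "w \<bullet> B w = (l - ?s\<^sup>2) * (norm w)\<^sup>2"
      by (simp add: B_def w(2) inner_diff_right dot_square_norm algebra_simps)
    then show "?s\<^sup>2 \<le> l" using Bpos[of w] w(1) by (simp add: zero_le_mult_iff)
  qed
  then have "sigma_min Z = ?s" by (simp add: sigma_min_def lambda_min_def)
  with v(1) low show ?thesis by metis
qed

lemma sigma_min_mult_norm_le: "sigma_min Z * norm w \<le> norm (transpose Z *v w)"
  for Z :: "real^'m^'n"
  using sigma_min_variational by blast

lemma sigma_min_nonneg: "0 \<le> sigma_min Z" for Z :: "real^'m^'n"
  using sigma_min_variational[of Z] by (metis norm_ge_zero)

text \<open>Evaluate \<open>transpose Z\<close> at the unit vector that is minimal for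
  \<open>Z'\<close>.\<close>

lemma sigma_min_diff_le: "sigma_min Z \<le> sigma_min Z' + norm (Z - Z')" for Z :: "real^'m^'n"
proof -
  obtain v where v: "norm v = 1" "norm (transpose Z' *v v) = sigma_min Z'"
    using sigma_min_variational by blast
  have "transpose Z *v v = transpose Z' *v v + transpose (Z - Z') *v v"
    by (simp add: vec_eq_iff transpose_def matrix_vector_mult_def algebra_simps flip: sum.distrib)
  then have "norm (transpose Z *v v) \<le> norm (transpose Z' *v v) + norm (transpose (Z - Z') *v v)"
    by (metis norm_triangle_ineq)
  moreover have "norm (transpose (Z - Z') *v v) \<le> norm (Z - Z') * norm v"
    by (rule norm_transpose_mult_le) (rule norm_matrix_vector_mult_le)
  ultimately show ?thesis using sigma_min_mult_norm_le[of Z v] v by simp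
qed

section \<open>Vectorization\<close>

definition unvecm :: "real^('n \<times> 'r) \<Rightarrow> real^'n^'r" where
  "unvecm v = (\<chi> i j. v $ (j, i))"

text \<open>The matrix form of the diagonal factors \<open>Dmat\<close> and \<open>Emat\<close>:
  entrywise multiplication by the step function of \<open>U\<close>, with value 0 at 0.\<close>

definition mask :: "real^'n^'r \<Rightarrow> real^'n^'r \<Rightarrow> real^'n^'r" where
  "mask U M = (\<chi> i j. if U $ i $ j > 0 then M $ i $ j else 0)"

lemma unvecm_vecm [simp]: "unvecm (vecm M) = M"
  by (simp add: unvecm_def vecm_def)

lemma vecm_unvecm [simp]: "vecm (unvecm v) = v"
  by (simp add: unvecm_def vecm_def vec_eq_iff)

lemma sum_UNIV_pair: "(\<Sum>p\<in>UNIV. f p) = (\<Sum>a\<in>UNIV. \<Sum>b\<in>UNIV. f (a, b))"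
  for f :: "'a::finite \<times> 'b::finite \<Rightarrow> real"
  by (simp add: sum.cartesian_product flip: UNIV_Times_UNIV)

lemma inner_vecm: "vecm M \<bullet> vecm N = M \<bullet> N"
  by (simp add: inner_vec_def vecm_def sum_UNIV_pair) (rule sum.swap)

lemma norm_vecm [simp]: "norm (vecm M) = norm M"
  by (simp add: norm_eq_sqrt_inner inner_vecm)

lemma vecm_add: "vecm (M + N) = vecm M + vecm N"
  and vecm_diff: "vecm (M - N) = vecm M - vecm N"
  and vecm_scaleR: "vecm (c *\<^sub>R M) = c *\<^sub>R vecm M"
  by (simp_all add: vecm_def vec_eq_iff)

lemma bounded_linear_unvecm: "bounded_linear (unvecm :: real^('n::finite \<times> 'r::finite) \<Rightarrow> _)"
proof
  show "\<exists>K. \<forall>v :: real^('n \<times> 'r). norm (unvecm v) \<le> norm v * K"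
    by (metis mult.right_neutral norm_vecm order_refl vecm_unvecm)
qed (simp_all add: unvecm_def vec_eq_iff)

text \<open>Translates the Kronecker products of the gradient formulas into ordinary matrix
  products, for which the norm estimates above are available.\<close>

lemma kron_mult_vecm: "kron P R *v vecm V = vecm (R ** V ** transpose P)"
proof -
  have "(\<Sum>a\<in>UNIV. \<Sum>b\<in>UNIV. P $ j $ a * R $ i $ b * V $ b $ a)
      = (\<Sum>a\<in>UNIV. (\<Sum>b\<in>UNIV. R $ i $ b * V $ b $ a) * P $ j $ a)" for i j
    by (simp add: sum_distrib_left sum_distrib_right algebra_simps)
  then show ?thesis
    by (simp add: vec_eq_iff kron_def vecm_def matrix_vector_mult_def matrix_matrix_mult_def
        transpose_def sum_UNIV_pair)
qed

lemma diagm_mult: "diagm d *v v = (\<chi> p. d $ p * v $ p)"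
  by (simp add: vec_eq_iff diagm_def matrix_vector_mult_def if_distrib[of "\<lambda>x. x * _"] cong: if_cong)

lemma diagm_indicator_mult_vecm:
  "diagm (vecm (\<chi> i j. if U $ i $ j > 0 then 1 else 0)) *v vecm V = vecm (mask U V)"
  by (simp add: diagm_mult vec_eq_iff vecm_def mask_def)

lemma rowkron_id_mult_vecm: "rowkron_id b *v vecm V = V *v b"
proof -
  have "(\<Sum>a\<in>UNIV. \<Sum>c\<in>UNIV. b $ a * (if c = i then 1 else 0) * V $ c $ a)
      = (\<Sum>a\<in>UNIV. V $ i $ a * b $ a)" for i
    by (intro sum.cong refl) (simp add: if_distrib[of "\<lambda>x. _ * x"] if_distrib[of "\<lambda>x. x * _"] mult.commute cong: if_cong)
  then show ?thesis
    by (simp add: vec_eq_iff rowkron_id_def vecm_def matrix_vector_mult_def sum_UNIV_pair)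
qed

lemma norm_entrywise_le:
  fixes M N :: "real^'n^'r"
  assumes "\<And>i j. \<bar>M $ i $ j\<bar> \<le> \<bar>N $ i $ j\<bar>"
  shows "norm M \<le> norm N"
  by (intro norm_vec_mono) (use assms in simp)

lemma norm_mask_le: "norm (mask U M) \<le> norm M"
  by (rule norm_entrywise_le) (simp add: mask_def)

lemma matrix_scaleR_vector: "(c *\<^sub>R M) *v x = c *\<^sub>R (M *v x)" for M :: "real^'n^'m"
  by (simp add: vec_eq_iff matrix_vector_mult_def sum_distrib_left mult.assoc)

section \<open>The implicit equation\<close>

abbreviation preact where
  "preact \<gamma> X W A \<equiv> \<gamma> *\<^sub>R (Zeq \<gamma> X W A ** A) + Phi X W"

text \<open>The term containing \<open>D\<close> on the right is at most \<open>g * norm D\<close>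
  and is absorbed on the left. The same absorption bounds the equilibrium, its differences and the
  error of its difference quotients.\<close>

lemma implicit_bound:
  fixes D R :: "real^'m^'N" and A :: "real^'m^'m"
  assumes "\<gamma> \<ge> 0" "\<gamma> * spec_norm A \<le> g" "norm D \<le> norm (\<gamma> *\<^sub>R (D ** A) + R)"
  shows "(1 - g) * norm D \<le> norm R"
proof -
  have "norm D \<le> \<gamma> * norm (D ** A) + norm R"
    using assms norm_triangle_ineq[of "\<gamma> *\<^sub>R (D ** A)" R] by simp
  also have "\<gamma> * norm (D ** A) \<le> \<gamma> * (norm D * spec_norm A)"
    by (intro mult_left_mono norm_matrix_mult_spec assms)
  also have "\<dots> = (\<gamma> * spec_norm A) * norm D" by simp
  also have "\<dots> \<le> g * norm D" by (intro mult_right_mono assms) simp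
  finally show ?thesis by (simp add: algebra_simps)
qed

text \<open>Banach's fixed point theorem with factor \<gamma> times the spectral norm of
  \<open>A\<close>. The nonexpansive \<open>G\<close> is kept general because it is applied both to
  \<open>relu_mat\<close> and to the one-sided derivative \<open>drelu_mat\<close>.\<close>

lemma implicit_ex1:
  fixes B :: "real^'m^'N" and A :: "real^'m^'m"
  assumes \<gamma>: "\<gamma> \<ge> 0" "\<gamma> * spec_norm A < 1"
    and G: "\<And>M M'. norm (G M - G M') \<le> norm (M - M')"
  shows "\<exists>!Z :: real^'m^'N. Z = G (\<gamma> *\<^sub>R (Z ** A) + B)"
proof -
  have "norm (G (\<gamma> *\<^sub>R (Z ** A) + B) - G (\<gamma> *\<^sub>R (Z' ** A) + B)) \<le> (\<gamma> * spec_norm A) * norm (Z - Z')" for Z Z'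
  proof -
    have "norm (G (\<gamma> *\<^sub>R (Z ** A) + B) - G (\<gamma> *\<^sub>R (Z' ** A) + B)) \<le> norm (\<gamma> *\<^sub>R ((Z - Z') ** A))"
      using G[of "\<gamma> *\<^sub>R (Z ** A) + B" "\<gamma> *\<^sub>R (Z' ** A) + B"]
      by (simp add: scaleR_diff_right bounded_bilinear.diff_left[OF bounded_bilinear_matrix_mult])
    also have "\<dots> \<le> \<gamma> * (norm (Z - Z') * spec_norm A)"
      using \<gamma> by (simp add: mult_left_mono norm_matrix_mult_spec)
    finally show ?thesis by (simp add: mult.commute mult.left_commute)
  qed
  then have "\<exists>!Z. G (\<gamma> *\<^sub>R (Z ** A) + B) = Z"
    using \<gamma> by (intro banach_fix_type[of "\<gamma> * spec_norm A"]) (auto simp: dist_norm spec_norm_nonneg)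
  then show ?thesis by metis
qed

lemma relu_mat_nonexpansive: "norm (relu_mat M - relu_mat M') \<le> norm (M - M')"
  by (rule norm_entrywise_le) (auto simp: relu_mat_def max_def)

lemma norm_relu_mat_le: "norm (relu_mat M) \<le> norm M"
  by (rule norm_entrywise_le) (auto simp: relu_mat_def max_def)

lemma Zeq_fixpoint:
  assumes "\<gamma> \<ge> 0" "\<gamma> * spec_norm A < 1"
  shows "Zeq \<gamma> X W A = relu_mat (preact \<gamma> X W A)"
  unfolding Zeq_def by (rule theI', rule implicit_ex1) (use assms relu_mat_nonexpansive in auto)

lemma norm_Zeq_le:
  assumes "\<gamma> \<ge> 0" "\<gamma> * spec_norm A \<le> g" "g < 1"
  shows "(1 - g) * norm (Zeq \<gamma> X W A) \<le> norm X * spec_norm W"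
proof -
  have "(1 - g) * norm (Zeq \<gamma> X W A) \<le> norm (Phi X W)"
    by (rule implicit_bound[OF assms(1,2)])
      (use Zeq_fixpoint[of \<gamma> A X W] norm_relu_mat_le[of "preact \<gamma> X W A"] assms in simp)
  also have "\<dots> \<le> norm X * spec_norm W"
    unfolding Phi_def using norm_relu_mat_le norm_matrix_mult_spec order_trans by blast
  finally show ?thesis .
qed

lemma norm_Phi_diff_le: "norm (Phi X W - Phi X W') \<le> norm X * norm (W - W')"
proof -
  have "norm (Phi X W - Phi X W') \<le> norm (X ** W - X ** W')"
    unfolding Phi_def by (rule relu_mat_nonexpansive)
  also have "X ** W - X ** W' = X ** (W - W')"
    by (rule bounded_bilinear.diff_right[OF bounded_bilinear_matrix_mult, symmetric])
  also have "norm \<dots> \<le> norm X * norm (W - W')" by (rule norm_matrix_mult_le)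
  finally show ?thesis .
qed

lemma norm_Zeq_diff_le:
  assumes \<gamma>: "\<gamma> \<ge> 0" "g < 1" and A: "\<gamma> * spec_norm A \<le> g" and A': "\<gamma> * spec_norm A' \<le> g"
  shows "(1 - g) * norm (Zeq \<gamma> X W' A' - Zeq \<gamma> X W A)
    \<le> \<gamma> * norm (Zeq \<gamma> X W A) * norm (A' - A) + norm X * norm (W' - W)"
proof -
  let ?Z = "Zeq \<gamma> X W A" and ?Z' = "Zeq \<gamma> X W' A'"
  \<comment> \<open>The difference of products is split so that the change of the equilibrium meets
    \<open>A'\<close>, where it can be absorbed, while the change of \<open>A\<close> meets the
    equilibrium at the reference point only.\<close>
  have "preact \<gamma> X W' A' - preact \<gamma> X W A
      = \<gamma> *\<^sub>R ((?Z' - ?Z) ** A') + (\<gamma> *\<^sub>R (?Z ** (A' - A)) + (Phi X W' - Phi X W))"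
    by (simp add: algebra_simps bounded_bilinear.diff_left[OF bounded_bilinear_matrix_mult]
        bounded_bilinear.diff_right[OF bounded_bilinear_matrix_mult])
  moreover have "norm (?Z' - ?Z) \<le> norm (preact \<gamma> X W' A' - preact \<gamma> X W A)"
    using relu_mat_nonexpansive[of "preact \<gamma> X W' A'" "preact \<gamma> X W A"]
      Zeq_fixpoint[OF \<gamma>(1), of A X W] Zeq_fixpoint[OF \<gamma>(1), of A' X W'] assms by simp
  ultimately have "(1 - g) * norm (?Z' - ?Z) \<le> norm (\<gamma> *\<^sub>R (?Z ** (A' - A)) + (Phi X W' - Phi X W))"
    using implicit_bound[OF \<gamma>(1) A'] by metis
  also have "\<dots> \<le> \<gamma> * norm (?Z ** (A' - A)) + norm (Phi X W' - Phi X W)"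
    using norm_triangle_ineq[of "\<gamma> *\<^sub>R (?Z ** (A' - A))"] \<gamma> by simp
  also have "\<dots> \<le> \<gamma> * (norm ?Z * norm (A' - A)) + norm X * norm (W' - W)"
    by (intro add_mono mult_left_mono norm_matrix_mult_le norm_Phi_diff_le \<gamma>)
  finally show ?thesis by (simp add: mult.assoc)
qed

section \<open>The backward pass\<close>

lemma Dmat_mult_vecm: "Dmat \<gamma> X W A *v vecm V = vecm (mask (preact \<gamma> X W A) V)"
  unfolding Dmat_def by (rule diagm_indicator_mult_vecm)

lemma Emat_mult_vecm: "Emat X W *v vecm V = vecm (mask (X ** W) V)"
  unfolding Emat_def by (rule diagm_indicator_mult_vecm)

lemma Qmat_mult_vecm:
  "Qmat \<gamma> X W A *v vecm V = vecm (V - \<gamma> *\<^sub>R mask (preact \<gamma> X W A) (V ** A))"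
  by (simp add: Qmat_def matrix_vector_mult_diff_rdistrib matrix_scaleR_vector kron_mult_vecm
      Dmat_mult_vecm vecm_diff vecm_scaleR flip: matrix_vector_mul_assoc)

text \<open>\<open>Q\<close> is the identity minus a map of norm at most \<open>g\<close>, since
  masking does not increase the norm. The bound yields both injectivity, hence invertibility, and
  the norm of the inverse.\<close>

lemma Qmat_lower_bound:
  fixes X :: "real^'d^'N" and A :: "real^'m^'m" and v :: "real^('m \<times> 'N)"
  assumes "\<gamma> \<ge> 0" "\<gamma> * spec_norm A \<le> g"
  shows "(1 - g) * norm v \<le> norm (Qmat \<gamma> X W A *v v)"
proof -
  define V :: "real^'m^'N" where "V = unvecm v"
  let ?R = "V - \<gamma> *\<^sub>R mask (preact \<gamma> X W A) (V ** A)"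
  have "\<gamma> * norm (mask (preact \<gamma> X W A) (V ** A)) \<le> \<gamma> * (norm V * spec_norm A)"
    by (intro mult_left_mono order_trans[OF norm_mask_le] norm_matrix_mult_spec assms)
  also have "\<dots> \<le> g * norm V"
    using mult_right_mono[OF assms(2), of "norm V"] by (simp add: algebra_simps)
  finally have "(1 - g) * norm V \<le> norm ?R"
    using norm_triangle_ineq2[of V "\<gamma> *\<^sub>R mask (preact \<gamma> X W A) (V ** A)"] assms(1)
    by (simp add: algebra_simps)
  moreover have "v = vecm V" by (simp add: V_def)
  ultimately show ?thesis by (simp add: Qmat_mult_vecm)
qed

section \<open>Inverse of \<open>Q\<close> and norm bounds for the gradients\<close>

lemma matrix_inv_mult:
  fixes Q :: "real^'n^'n"
  assumes "invertible Q"
  shows "Q ** matrix_inv Q = mat 1" "matrix_inv Q ** Q = mat 1"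
proof -
  have "Q ** matrix_inv Q = mat 1 \<and> matrix_inv Q ** Q = mat 1"
    unfolding matrix_inv_def using assms unfolding invertible_def by (rule someI_ex)
  then show "Q ** matrix_inv Q = mat 1" "matrix_inv Q ** Q = mat 1" by auto
qed

lemma invertible_Qmat:
  assumes "\<gamma> \<ge> 0" "\<gamma> * spec_norm A < 1"
  shows "invertible (Qmat \<gamma> X W A)"
proof -
  have "v = 0" if "Qmat \<gamma> X W A *v v = 0" for v
    using Qmat_lower_bound[OF assms(1) order_refl, of A v X W] that assms
    by (simp add: mult_le_0_iff)
  then show ?thesis
    by (simp add: invertible_left_inverse matrix_left_invertible_ker)
qed

lemma norm_Qmat_inv_le:
  assumes "\<gamma> \<ge> 0" "\<gamma> * spec_norm A \<le> g" "g < 1"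
  shows "norm (matrix_inv (Qmat \<gamma> X W A) *v v) \<le> 1 / (1 - g) * norm v"
proof -
  have "invertible (Qmat \<gamma> X W A)" using assms by (intro invertible_Qmat) auto
  then have "Qmat \<gamma> X W A *v (matrix_inv (Qmat \<gamma> X W A) *v v) = v"
    by (simp add: matrix_vector_mul_assoc matrix_inv_mult)
  then show ?thesis
    using Qmat_lower_bound[OF assms(1,2), of "matrix_inv (Qmat \<gamma> X W A) *v v" X W] assms(3)
    by (simp add: field_simps)
qed

lemma norm_back_vec_le:
  fixes X :: "real^'d^'N" and b :: "real^'m"
  assumes "\<gamma> \<ge> 0" "\<gamma> * spec_norm A \<le> g" "g < 1"
  shows "norm (back_vec \<gamma> X y W A b) \<le> 1 / (1 - g) * (norm b * norm (yhat \<gamma> X W A b - y))"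
proof -
  let ?r = "yhat \<gamma> X W A b - y"
  have "norm (rowkron_id b *v v) \<le> norm b * norm v" for v :: "real^('m \<times> 'N)"
    using norm_matrix_vector_mult_le[of "unvecm v" b] rowkron_id_mult_vecm[of b "unvecm v"] norm_vecm[of "unvecm v"]
    by (simp add: mult.commute)
  then have "norm (transpose (rowkron_id b :: real^('m \<times> 'N)^'N) *v ?r) \<le> norm b * norm ?r"
    by (rule norm_transpose_mult_le)
  moreover have "norm (back_vec \<gamma> X y W A b) \<le> 1 / (1 - g) * norm (transpose (rowkron_id b :: real^('m \<times> 'N)^'N) *v ?r)"
    unfolding back_vec_def by (intro norm_transpose_mult_le norm_Qmat_inv_le assms)
  moreover have "1 / (1 - g) \<ge> 0" using assms by simp
  ultimately show ?thesis using mult_left_mono order_trans by blast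
qed

text \<open>Before transposition the operator is left multiplication by \<open>X\<close> followed by
  two masks, neither of which increases the norm.\<close>

lemma norm_gradW_le:
  fixes X :: "real^'d^'N" and b :: "real^'m"
  assumes "\<gamma> \<ge> 0" "\<gamma> * spec_norm A \<le> g" "g < 1"
  shows "norm (gradW \<gamma> X y W A b) \<le> norm X * (1 / (1 - g) * (norm b * norm (yhat \<gamma> X W A b - y)))"
proof -
  have "norm ((Dmat \<gamma> X W A ** Emat X W ** kron (mat 1 :: real^'m^'m) X) *v v) \<le> norm X * norm v" for v
  proof -
    define V :: "real^'m^'d" where "V = unvecm v"
    have v: "v = vecm V" by (simp add: V_def)
    show ?thesis unfolding v
      by (simp add: Dmat_mult_vecm Emat_mult_vecm kron_mult_vecm flip: matrix_vector_mul_assoc)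
        (meson norm_mask_le norm_matrix_mult_le order_trans)
  qed
  then have "norm (gradW \<gamma> X y W A b) \<le> norm X * norm (back_vec \<gamma> X y W A b)"
    unfolding gradW_def by (rule norm_transpose_mult_le)
  also have "\<dots> \<le> norm X * (1 / (1 - g) * (norm b * norm (yhat \<gamma> X W A b - y)))"
    by (intro mult_left_mono norm_back_vec_le assms) simp
  finally show ?thesis .
qed

lemma norm_gradA_le:
  fixes X :: "real^'d^'N" and b :: "real^'m"
  assumes "\<gamma> \<ge> 0" "\<gamma> * spec_norm A \<le> g" "g < 1"
  shows "norm (gradA \<gamma> X y W A b)
    \<le> \<gamma> * norm (Zeq \<gamma> X W A) * (1 / (1 - g) * (norm b * norm (yhat \<gamma> X W A b - y)))"
proof -
  let ?Z = "Zeq \<gamma> X W A"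
  have "norm ((Dmat \<gamma> X W A ** kron (mat 1 :: real^'m^'m) ?Z) *v v) \<le> norm ?Z * norm v" for v
  proof -
    define V :: "real^'m^'m" where "V = unvecm v"
    have v: "v = vecm V" by (simp add: V_def)
    show ?thesis unfolding v
      by (simp add: Dmat_mult_vecm kron_mult_vecm flip: matrix_vector_mul_assoc)
        (meson norm_mask_le norm_matrix_mult_le order_trans)
  qed
  then have "norm (gradA \<gamma> X y W A b) \<le> \<gamma> * (norm ?Z * norm (back_vec \<gamma> X y W A b))"
    unfolding gradA_def norm_scaleR using assms(1)
    by (metis abs_of_nonneg mult_left_mono norm_transpose_mult_le)
  also have "\<dots> \<le> \<gamma> * (norm ?Z * (1 / (1 - g) * (norm b * norm (yhat \<gamma> X W A b - y))))"
    by (intro mult_left_mono norm_back_vec_le assms) simp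
  finally show ?thesis by (simp add: mult.assoc)
qed

lemma norm_gradb_le: "norm (gradb \<gamma> X y W A b) \<le> norm (Zeq \<gamma> X W A) * norm (yhat \<gamma> X W A b - y)"
  unfolding gradb_def by (intro norm_transpose_mult_le norm_matrix_vector_mult_le)

text \<open>The formulas for the gradients compute the derivative of the loss along any direction in
  which the output moves according to the linearized equation with the convention \<open>\<sigma>'(0) = 0\<close>.\<close>

lemma inner_residual_linearized:
  fixes X :: "real^'d^'N" and W W' :: "real^'m^'d" and A A' :: "real^'m^'m" and V :: "real^'m^'N"
  assumes \<gamma>: "\<gamma> \<ge> 0" "\<gamma> * spec_norm A < 1"
    and V: "V = mask (preact \<gamma> X W A) (\<gamma> *\<^sub>R (V ** A + Zeq \<gamma> X W A ** A') + mask (X ** W) (X ** W'))"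
  shows "(yhat \<gamma> X W A b - y) \<bullet> (V *v b)
    = gradW \<gamma> X y W A b \<bullet> vecm W' + gradA \<gamma> X y W A b \<bullet> vecm A'"
proof -
  let ?r = "yhat \<gamma> X W A b - y" and ?Q = "Qmat \<gamma> X W A" and ?Z = "Zeq \<gamma> X W A"
  let ?MW = "Dmat \<gamma> X W A ** Emat X W ** kron (mat 1 :: real^'m^'m) X"
  let ?MA = "Dmat \<gamma> X W A ** kron (mat 1 :: real^'m^'m) ?Z"
  let ?R = "rowkron_id b :: real^('m \<times> 'N)^'N"
  have mask_lin: "mask U (c *\<^sub>R (M + N) + L) = c *\<^sub>R mask U M + (c *\<^sub>R mask U N + mask U L)"
    for U M N L :: "real^'m^'N" and c
    by (simp add: mask_def vec_eq_iff algebra_simps)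
  \<comment> \<open>Collecting the terms in \<open>V\<close> on the left turns the linearized
    equation into a linear system with matrix \<open>Q\<close>. Its right-hand side
    \<open>?w\<close> is linear in the directions \<open>W'\<close> and \<open>A'\<close>, and
    moving all operators to the other side of the inner product produces the gradients.\<close>
  have "V - \<gamma> *\<^sub>R mask (preact \<gamma> X W A) (V ** A)
      = \<gamma> *\<^sub>R mask (preact \<gamma> X W A) (?Z ** A') + mask (preact \<gamma> X W A) (mask (X ** W) (X ** W'))"
    using V mask_lin by (metis add_diff_cancel_left')
  then have "?Q *v vecm V = ?MW *v vecm W' + \<gamma> *\<^sub>R (?MA *v vecm A')" (is "_ = ?w")
    by (simp add: Qmat_mult_vecm Dmat_mult_vecm Emat_mult_vecm kron_mult_vecm vecm_add vecm_scaleR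
        flip: matrix_vector_mul_assoc)
  then have "vecm V = matrix_inv ?Q *v ?w"
    using matrix_inv_mult(2)[OF invertible_Qmat[OF \<gamma>, of X W]]
    by (metis matrix_vector_mul_assoc matrix_vector_mul_lid)
  then have "?r \<bullet> (V *v b) = ?r \<bullet> (?R *v (matrix_inv ?Q *v ?w))"
    using rowkron_id_mult_vecm[of b V] by simp
  also have "\<dots> = back_vec \<gamma> X y W A b \<bullet> ?w"
    unfolding back_vec_def inner_transpose_matrix_vector ..
  also have "\<dots> = back_vec \<gamma> X y W A b \<bullet> (?MW *v vecm W') + \<gamma> * (back_vec \<gamma> X y W A b \<bullet> (?MA *v vecm A'))"
    by (simp only: inner_add_right inner_scaleR_right)
  also have "\<dots> = gradW \<gamma> X y W A b \<bullet> vecm W' + gradA \<gamma> X y W A b \<bullet> vecm A'"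
    unfolding gradW_def gradA_def inner_scaleR_left inner_transpose_matrix_vector ..
  finally show ?thesis .
qed

section \<open>Right derivatives of the equilibrium\<close>

text \<open>Difference quotients are the form in which the implicit equation for the derivative can
  be estimated.\<close>

lemma has_vector_derivative_at_right_iff:
  "(f has_vector_derivative f') (at_right t) \<longleftrightarrow>
    ((\<lambda>s. (f s - f t) /\<^sub>R (s - t)) \<longlongrightarrow> f') (at_right t)"
proof -
  have "norm (f s - f t - (s - t) *\<^sub>R f') / norm (s - t) = norm ((f s - f t) /\<^sub>R (s - t) - f')"
    if "t < s" for s
  proof -
    have "(f s - f t) /\<^sub>R (s - t) - f' = (f s - f t - (s - t) *\<^sub>R f') /\<^sub>R (s - t)"
      using that by (simp add: scaleR_diff_right)
    then show ?thesis using that by (simp add: divide_inverse mult.commute)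
  qed
  then have "eventually (\<lambda>s. norm (f s - f t - (s - t) *\<^sub>R f') / norm (s - t)
      = norm ((f s - f t) /\<^sub>R (s - t) - f')) (at_right t)"
    by (auto simp: eventually_at_filter)
  from tendsto_cong[OF this] show ?thesis
    by (simp add: has_vector_derivative_def has_derivative_iff_norm bounded_linear_scaleR_left
        tendsto_norm_zero_iff flip: Lim_null)
qed

lemma has_vector_derivative_at_right_tendsto:
  assumes "(f has_vector_derivative f') (at_right t)"
  shows "(f \<longlongrightarrow> f t) (at_right t)"
  using has_derivative_continuous[OF assms[unfolded has_vector_derivative_def]]
  by (simp add: continuous_within)

text \<open>The one-sided directional derivative of \<open>\<sigma>\<close> at \<open>u\<close> in direction \<open>w\<close>.\<close>

definition drelu :: "real \<Rightarrow> real \<Rightarrow> real" where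
  "drelu u w = (if u > 0 then w else if u = 0 then max 0 w else 0)"

definition drelu_mat :: "real^'n^'m \<Rightarrow> real^'n^'m \<Rightarrow> real^'n^'m" where
  "drelu_mat U M = (\<chi> i j. drelu (U $ i $ j) (M $ i $ j))"

lemma drelu_mat_nonexpansive: "norm (drelu_mat U M - drelu_mat U M') \<le> norm (M - M')"
  by (rule norm_entrywise_le) (auto simp: drelu_mat_def drelu_def max_def)

text \<open>The identity is exact near \<open>t\<close>, before any limit is taken: if
  \<open>u t\<close> is nonzero, its sign persists, and if it is zero, \<open>max 0\<close> commutes
  with division by the positive number \<open>s - t\<close>.\<close>

lemma relu_difference_quotient:
  fixes u :: "real \<Rightarrow> real"
  assumes u: "(u \<longlongrightarrow> u t) (at_right t)"
  shows "eventually (\<lambda>s. (max 0 (u s) - max 0 (u t)) / (s - t) = drelu (u t) ((u s - u t) / (s - t))) (at_right t)"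
proof -
  have right: "eventually (\<lambda>s. t < s) (at_right t)" by (simp add: eventually_at_filter)
  consider "u t > 0" | "u t < 0" | "u t = 0" by linarith
  then show ?thesis
  proof cases
    case 1
    have "eventually (\<lambda>s. u s > 0) (at_right t)" by (rule order_tendstoD(1)[OF u 1])
    then show ?thesis by eventually_elim (use 1 in \<open>simp add: drelu_def max_def\<close>)
  next
    case 2
    have "eventually (\<lambda>s. u s < 0) (at_right t)" by (rule order_tendstoD(2)[OF u 2])
    then show ?thesis by eventually_elim (use 2 in \<open>simp add: drelu_def max_def\<close>)
  next
    case 3
    from right show ?thesis
      by eventually_elim (use 3 in \<open>auto simp: drelu_def max_def divide_le_0_iff zero_le_divide_iff\<close>)
  qed
qed

lemma relu_mat_difference_quotient:
  fixes U :: "real \<Rightarrow> real^'n^'m"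
  assumes U: "(U \<longlongrightarrow> U t) (at_right t)"
  shows "eventually (\<lambda>s. (relu_mat (U s) - relu_mat (U t)) /\<^sub>R (s - t)
    = drelu_mat (U t) ((U s - U t) /\<^sub>R (s - t))) (at_right t)"
proof -
  have "eventually (\<lambda>s. (max 0 (U s $ i $ j) - max 0 (U t $ i $ j)) / (s - t)
      = drelu (U t $ i $ j) ((U s $ i $ j - U t $ i $ j) / (s - t))) (at_right t)" for i j
    by (rule relu_difference_quotient[of "\<lambda>s. U s $ i $ j"]) (intro tendsto_vec_nth U)
  then have "eventually (\<lambda>s. \<forall>i j. (max 0 (U s $ i $ j) - max 0 (U t $ i $ j)) / (s - t)
      = drelu (U t $ i $ j) ((U s $ i $ j - U t $ i $ j) / (s - t))) (at_right t)"
    by (intro eventually_all_finite)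
  then show ?thesis
    by eventually_elim
      (simp add: vec_eq_iff relu_mat_def drelu_mat_def divide_inverse mult.commute)
qed

lemma relu_mat_has_right_derivative:
  fixes U :: "real \<Rightarrow> real^'n^'m"
  assumes U: "(U has_vector_derivative U') (at_right t)"
  shows "((\<lambda>s. relu_mat (U s)) has_vector_derivative drelu_mat (U t) U') (at_right t)"
proof -
  let ?q = "\<lambda>s. (U s - U t) /\<^sub>R (s - t)"
  have "(?q \<longlongrightarrow> U') (at_right t)" using U by (simp add: has_vector_derivative_at_right_iff)
  then have "((\<lambda>s. norm (?q s - U')) \<longlongrightarrow> 0) (at_right t)"
    by (simp add: tendsto_norm_zero_iff flip: Lim_null)
  then have "((\<lambda>s. drelu_mat (U t) (?q s) - drelu_mat (U t) U') \<longlongrightarrow> 0) (at_right t)"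
    by (rule tendsto_0_le[where K = 1]) (simp add: drelu_mat_nonexpansive)
  then have "((\<lambda>s. drelu_mat (U t) (?q s)) \<longlongrightarrow> drelu_mat (U t) U') (at_right t)"
    by (simp flip: Lim_null)
  then show ?thesis
    unfolding has_vector_derivative_at_right_iff
    by (rule Lim_transform_eventually)
      (use relu_mat_difference_quotient[OF has_vector_derivative_at_right_tendsto[OF U]] in
        \<open>auto elim: eventually_mono\<close>)
qed

lemma tendsto_Zeq:
  assumes \<gamma>: "\<gamma> \<ge> 0" "g < 1"
    and W: "(W \<longlongrightarrow> W0) F" and A: "(A \<longlongrightarrow> A0) F"
    and bnd: "\<gamma> * spec_norm A0 \<le> g" "eventually (\<lambda>s. \<gamma> * spec_norm (A s) \<le> g) F"
  shows "((\<lambda>s. Zeq \<gamma> X (W s) (A s)) \<longlongrightarrow> Zeq \<gamma> X W0 A0) F"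
proof -
  let ?Z = "Zeq \<gamma> X W0 A0"
  let ?b = "\<lambda>s. (\<gamma> * norm ?Z * norm (A s - A0) + norm X * norm (W s - W0)) / (1 - g)"
  have "(?b \<longlongrightarrow> (\<gamma> * norm ?Z * norm (A0 - A0) + norm X * norm (W0 - W0)) / (1 - g)) F"
    using \<gamma> by (intro tendsto_intros A W) simp
  then have lim: "(?b \<longlongrightarrow> 0) F" by simp
  have "eventually (\<lambda>s. norm (Zeq \<gamma> X (W s) (A s) - ?Z) \<le> norm (?b s) * 1) F"
    using bnd(2)
  proof eventually_elim
    case (elim s)
    then have "norm (Zeq \<gamma> X (W s) (A s) - ?Z) \<le> ?b s"
      using norm_Zeq_diff_le[OF \<gamma> bnd(1), of "A s" X "W s" W0] \<gamma>
      by (simp add: pos_le_divide_eq mult.commute)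
    also have "\<dots> \<le> norm (?b s) * 1" by (simp only: real_norm_def mult_1_right abs_ge_self)
    finally show ?case .
  qed
  from tendsto_0_le[OF lim this] show ?thesis by (simp flip: Lim_null)
qed

lemma Phi_has_right_derivative:
  assumes "(W has_vector_derivative W') (at_right t)"
  shows "((\<lambda>s. Phi X (W s)) has_vector_derivative drelu_mat (X ** W t) (X ** W')) (at_right t)"
  unfolding Phi_def
  by (rule relu_mat_has_right_derivative)
    (rule bounded_linear.has_vector_derivative[OF bounded_bilinear.bounded_linear_right[OF bounded_bilinear_matrix_mult] assms])

text \<open>The candidate \<open>V\<close> is first obtained as the unique solution of the equation
  that a derivative would satisfy. The difference quotients of the equilibrium satisfy the same
  equation up to a remainder tending to 0, so the contraction property forces them to converge to
  \<open>V\<close>.\<close>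

lemma Zeq_has_right_derivative:
  fixes X :: "real^'d^'N" and W :: "real \<Rightarrow> real^'m^'d" and A :: "real \<Rightarrow> real^'m^'m"
  assumes \<gamma>: "\<gamma> \<ge> 0" "g < 1"
    and W: "(W has_vector_derivative W') (at_right t)"
    and A: "(A has_vector_derivative A') (at_right t)"
    and bnd: "\<gamma> * spec_norm (A t) \<le> g" "eventually (\<lambda>s. \<gamma> * spec_norm (A s) \<le> g) (at_right t)"
  obtains V where "((\<lambda>s. Zeq \<gamma> X (W s) (A s)) has_vector_derivative V) (at_right t)"
    "V = drelu_mat (preact \<gamma> X (W t) (A t))
      (\<gamma> *\<^sub>R (V ** A t + Zeq \<gamma> X (W t) (A t) ** A') + drelu_mat (X ** W t) (X ** W'))"
proof -
  let ?F = "at_right t"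
  define Z where "Z s = Zeq \<gamma> X (W s) (A s)" for s
  define U where "U s = preact \<gamma> X (W s) (A s)" for s
  define \<Phi>' where "\<Phi>' = drelu_mat (X ** W t) (X ** W')"
  define dZ where "dZ s = (Z s - Z t) /\<^sub>R (s - t)" for s
  define dA where "dA s = (A s - A t) /\<^sub>R (s - t)" for s
  define d\<Phi> where "d\<Phi> s = (Phi X (W s) - Phi X (W t)) /\<^sub>R (s - t)" for s
  note mult_lin = bounded_bilinear.diff_left[OF bounded_bilinear_matrix_mult]
    bounded_bilinear.diff_right[OF bounded_bilinear_matrix_mult]
    bounded_bilinear.add_left[OF bounded_bilinear_matrix_mult]
    bounded_bilinear.add_right[OF bounded_bilinear_matrix_mult]
    bounded_bilinear.scaleR_left[OF bounded_bilinear_matrix_mult]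
    bounded_bilinear.scaleR_right[OF bounded_bilinear_matrix_mult]
  note mult_lim = bounded_bilinear.tendsto[OF bounded_bilinear_matrix_mult]
  have "\<exists>!V. V = drelu_mat (U t) (\<gamma> *\<^sub>R (V ** A t) + (\<gamma> *\<^sub>R (Z t ** A') + \<Phi>'))"
    by (rule implicit_ex1) (use \<gamma> bnd drelu_mat_nonexpansive in auto)
  then obtain V where V: "V = drelu_mat (U t) (\<gamma> *\<^sub>R (V ** A t) + (\<gamma> *\<^sub>R (Z t ** A') + \<Phi>'))" by blast
  have At: "(A \<longlongrightarrow> A t) ?F" and Wt: "(W \<longlongrightarrow> W t) ?F"
    using A W has_vector_derivative_at_right_tendsto by blast+
  have Pt: "((\<lambda>s. Phi X (W s)) \<longlongrightarrow> Phi X (W t)) ?F"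
    using Phi_has_right_derivative[OF W] has_vector_derivative_at_right_tendsto by blast
  have "(Z \<longlongrightarrow> Z t) ?F" unfolding Z_def by (rule tendsto_Zeq[OF \<gamma> Wt At bnd])
  then have Ut: "(U \<longlongrightarrow> U t) ?F"
    unfolding U_def Z_def[symmetric] by (intro tendsto_intros mult_lim At Pt)
  have eq: "eventually (\<lambda>s. dZ s = drelu_mat (U t) ((U s - U t) /\<^sub>R (s - t))) ?F"
    using relu_mat_difference_quotient[OF Ut] bnd(2)
  proof eventually_elim
    case (elim s)
    have "Z s = relu_mat (U s)" "Z t = relu_mat (U t)"
      unfolding Z_def U_def using Zeq_fixpoint elim bnd(1) \<gamma> by (metis le_less_trans)+
    then show ?case using elim by (simp add: dZ_def)
  qed
  \<comment> \<open>An exact product rule for difference quotients: the quotient of \<open>Z\<close>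
    is paired with \<open>A s\<close>, that of \<open>A\<close> with \<open>Z t\<close>.\<close>
  have dU: "(U s - U t) /\<^sub>R (s - t) = \<gamma> *\<^sub>R (dZ s ** A s) + (\<gamma> *\<^sub>R (Z t ** dA s) + d\<Phi> s)" for s
    unfolding U_def Z_def[symmetric] dZ_def dA_def d\<Phi>_def by (simp add: mult_lin algebra_simps)
  \<comment> \<open>What remains of the difference of the two equations once
    \<open>(dZ s - V) ** A s\<close> is split off.\<close>
  define R where "R s = \<gamma> *\<^sub>R (V ** (A s - A t)) + (\<gamma> *\<^sub>R (Z t ** (dA s - A')) + (d\<Phi> s - \<Phi>'))" for s
  have "(R \<longlongrightarrow> \<gamma> *\<^sub>R (V ** (A t - A t)) + (\<gamma> *\<^sub>R (Z t ** (A' - A')) + (\<Phi>' - \<Phi>'))) ?F"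
    unfolding R_def
    using A Phi_has_right_derivative[OF W, of X] unfolding has_vector_derivative_at_right_iff
    by (intro tendsto_intros mult_lim At) (auto simp: dA_def[abs_def] d\<Phi>_def[abs_def] \<Phi>'_def)
  then have Rlim: "(R \<longlongrightarrow> 0) ?F" by (simp add: mult_lin)
  have "eventually (\<lambda>s. norm (dZ s - V) \<le> norm (R s) * (1 / (1 - g))) ?F"
    using eq bnd(2)
  proof eventually_elim
    case (elim s)
    have "norm (dZ s - V) \<le> norm ((\<gamma> *\<^sub>R (dZ s ** A s) + (\<gamma> *\<^sub>R (Z t ** dA s) + d\<Phi> s))
        - (\<gamma> *\<^sub>R (V ** A t) + (\<gamma> *\<^sub>R (Z t ** A') + \<Phi>')))"
      using elim(1) V drelu_mat_nonexpansive dU by metis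
    also have "(\<gamma> *\<^sub>R (dZ s ** A s) + (\<gamma> *\<^sub>R (Z t ** dA s) + d\<Phi> s))
        - (\<gamma> *\<^sub>R (V ** A t) + (\<gamma> *\<^sub>R (Z t ** A') + \<Phi>')) = \<gamma> *\<^sub>R ((dZ s - V) ** A s) + R s"
      unfolding R_def by (simp add: mult_lin algebra_simps)
    finally have "(1 - g) * norm (dZ s - V) \<le> norm (R s)"
      by (rule implicit_bound[OF \<gamma>(1) elim(2)])
    then show ?case using \<gamma> by (simp add: field_simps)
  qed
  from tendsto_0_le[OF Rlim this] have "(dZ \<longlongrightarrow> V) ?F" by (simp flip: Lim_null)
  then have "(Z has_vector_derivative V) ?F"
    unfolding has_vector_derivative_at_right_iff dZ_def[abs_def] .
  moreover have "V = drelu_mat (U t) (\<gamma> *\<^sub>R (V ** A t + Z t ** A') + \<Phi>')"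
    using V by (simp add: scaleR_add_right add.assoc)
  ultimately show thesis using that unfolding Z_def[abs_def] U_def \<Phi>'_def by blast
qed

text \<open>A nonzero limit would make the difference quotients, and with them \<open>u\<close>,
  nonzero immediately after \<open>t\<close>.\<close>

lemma right_derivative_zero_if_frequently_zero:
  fixes u :: "real \<Rightarrow> real"
  assumes "(u has_vector_derivative d) (at_right t)" "u t = 0" "\<exists>\<^sub>F s in at_right t. u s = 0"
  shows "d = 0"
proof (rule ccontr)
  assume "d \<noteq> 0"
  have "((\<lambda>s. (u s - u t) /\<^sub>R (s - t)) \<longlongrightarrow> d) (at_right t)"
    using assms(1) by (simp add: has_vector_derivative_at_right_iff)
  from tendsto_imp_eventually_ne[OF this \<open>d \<noteq> 0\<close>]
  have "eventually (\<lambda>s. u s \<noteq> 0) (at_right t)"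
    by eventually_elim (use assms(2) in auto)
  then show False using assms(3) by (simp add: frequently_def)
qed

text \<open>The times at which some entry of \<open>U\<close> vanishes but is nonzero immediately afterwards.
  At all other times the true right derivative of \<open>\<sigma>(U)\<close> obeys the convention \<open>\<sigma>'(0) = 0\<close>.\<close>

definition kinks :: "(real \<Rightarrow> real^'n^'m) \<Rightarrow> real set" where
  "kinks U = (\<Union>i. \<Union>j. {t\<in>{t. U t $ i $ j = 0}. \<not> (\<exists>\<^sub>F s in at_right t. s \<in> {t. U t $ i $ j = 0})})"

lemma countable_kinks: "countable (kinks U)"
  unfolding kinks_def by (intro countable_UN countable_isolated_from_right) auto

text \<open>The two sides can differ only at entries where \<open>U t\<close> is zero. Outside
  \<open>kinks U\<close> such an entry vanishes again arbitrarily soon, so its right derivative is 0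
  as well.\<close>

lemma drelu_mat_eq_mask:
  fixes U :: "real \<Rightarrow> real^'n^'m"
  assumes "t \<notin> kinks U" "(U has_vector_derivative U') (at_right t)"
  shows "drelu_mat (U t) U' = mask (U t) U'"
proof -
  have "U' $ i $ j = 0" if "U t $ i $ j = 0" for i j
  proof (rule right_derivative_zero_if_frequently_zero)
    show "((\<lambda>s. U s $ i $ j) has_vector_derivative U' $ i $ j) (at_right t)"
      by (intro bounded_linear.has_vector_derivative[OF bounded_linear_vec_nth] assms(2))
    show "\<exists>\<^sub>F s in at_right t. U s $ i $ j = 0" using assms(1) that unfolding kinks_def by auto
  qed (rule that)
  then show ?thesis by (simp add: vec_eq_iff drelu_mat_def drelu_def mask_def)
qed

lemma loss_has_right_derivative:
  fixes X :: "real^'d^'N" and W :: "real \<Rightarrow> real^'m^'d" and A :: "real \<Rightarrow> real^'m^'m" and b :: "real \<Rightarrow> real^'m"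
  assumes \<gamma>: "\<gamma> \<ge> 0" "g < 1"
    and W: "(W has_vector_derivative W') (at_right t)"
    and A: "(A has_vector_derivative A') (at_right t)"
    and b: "(b has_vector_derivative b') (at_right t)"
    and bnd: "\<gamma> * spec_norm (A t) \<le> g" "eventually (\<lambda>s. \<gamma> * spec_norm (A s) \<le> g) (at_right t)"
    and kinks: "t \<notin> kinks (\<lambda>s. preact \<gamma> X (W s) (A s))" "t \<notin> kinks (\<lambda>s. X ** W s)"
  shows "((\<lambda>s. loss \<gamma> X y (W s) (A s) (b s)) has_vector_derivative
    gradW \<gamma> X y (W t) (A t) (b t) \<bullet> vecm W' + gradA \<gamma> X y (W t) (A t) (b t) \<bullet> vecm A'
      + gradb \<gamma> X y (W t) (A t) (b t) \<bullet> b') (at_right t)"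
proof -
  let ?Z = "\<lambda>s. Zeq \<gamma> X (W s) (A s)"
  let ?r = "\<lambda>s. yhat \<gamma> X (W s) (A s) (b s) - y"
  obtain V where V: "(?Z has_vector_derivative V) (at_right t)"
    "V = drelu_mat (preact \<gamma> X (W t) (A t))
      (\<gamma> *\<^sub>R (V ** A t + ?Z t ** A') + drelu_mat (X ** W t) (X ** W'))"
    by (rule Zeq_has_right_derivative[OF \<gamma> W A bnd])
  have XW: "((\<lambda>s. X ** W s) has_vector_derivative X ** W') (at_right t)"
    by (rule bounded_linear.has_vector_derivative[OF bounded_bilinear.bounded_linear_right[OF bounded_bilinear_matrix_mult] W])
  have "((\<lambda>s. preact \<gamma> X (W s) (A s)) has_vector_derivative
      \<gamma> *\<^sub>R (?Z t ** A' + V ** A t) + drelu_mat (X ** W t) (X ** W')) (at_right t)"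
    by (intro has_vector_derivative_add Phi_has_right_derivative W
        bounded_linear.has_vector_derivative[OF bounded_linear_scaleR_right]
        bounded_bilinear.has_vector_derivative[OF bounded_bilinear_matrix_mult] V(1) A)
  \<comment> \<open>In each \<open>drelu_mat\<close> the direction is the right derivative of the
    very function at which it is evaluated, so both may be replaced by masks.\<close>
  then have "V = mask (preact \<gamma> X (W t) (A t)) (\<gamma> *\<^sub>R (V ** A t + ?Z t ** A') + mask (X ** W t) (X ** W'))"
    using V(2) drelu_mat_eq_mask[OF kinks(1)] drelu_mat_eq_mask[OF kinks(2) XW]
    by (simp add: add.commute)
  from inner_residual_linearized[OF \<gamma>(1) _ this, of "b t" y]
  have lin: "?r t \<bullet> (V *v b t) = gradW \<gamma> X y (W t) (A t) (b t) \<bullet> vecm W' + gradA \<gamma> X y (W t) (A t) (b t) \<bullet> vecm A'"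
    using bnd(1) \<gamma>(2) by simp
  have r': "(?r has_vector_derivative ?Z t *v b' + V *v b t) (at_right t)"
    unfolding yhat_def
    using has_vector_derivative_diff[OF bounded_bilinear.has_vector_derivative[OF bounded_bilinear_matrix_vector_mult V(1) b] has_vector_derivative_const[of y]]
    by simp
  have "((\<lambda>s. (1/2) * (?r s \<bullet> ?r s)) has_vector_derivative
      (1/2) * (?r t \<bullet> (?Z t *v b' + V *v b t) + (?Z t *v b' + V *v b t) \<bullet> ?r t)) (at_right t)"
    by (intro bounded_linear.has_vector_derivative[OF bounded_linear_mult_right]
        bounded_bilinear.has_vector_derivative[OF bounded_bilinear_inner r' r'])
  moreover have "(1/2) * (?r t \<bullet> (?Z t *v b' + V *v b t) + (?Z t *v b' + V *v b t) \<bullet> ?r t)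
      = ?r t \<bullet> (V *v b t) + ?r t \<bullet> (?Z t *v b')"
    by (simp add: inner_add_right inner_add_left inner_commute)
  moreover have "?r t \<bullet> (?Z t *v b') = gradb \<gamma> X y (W t) (A t) (b t) \<bullet> b'"
    unfolding gradb_def inner_transpose_matrix_vector ..
  ultimately show ?thesis unfolding loss_def power2_norm_eq_inner lin by (simp only:)
qed

section \<open>The trajectory\<close>

text \<open>The mean value inequality with majorant \<open>- k * exp (- a * t)\<close>. The factor
  \<open>1 - exp (- a * T)\<close> is kept because it is below 1 at every finite time, which later
  supplies strictness.\<close>

lemma exponential_decay_displacement:
  fixes f :: "real \<Rightarrow> 'a::real_normed_vector"
  assumes "0 \<le> T" and f: "\<And>t. 0 \<le> t \<Longrightarrow> (f has_vector_derivative f' t) (at t within {0..})"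
    and bnd: "\<And>t. 0 \<le> t \<Longrightarrow> t < T \<Longrightarrow> norm (f' t) \<le> k * a * exp (- a * t)"
  shows "norm (f T - f 0) \<le> k * (1 - exp (- a * T))"
proof (cases "T = 0")
  case False
  with assms(1) have "0 < T" by simp
  have "norm (f T - f 0) \<le> - k * exp (- a * T) - (- k * exp (- a * 0))"
  proof (rule differentiable_bound_general[OF \<open>0 < T\<close>, where f' = f' and \<phi>' = "\<lambda>t. k * a * exp (- a * t)"])
    have "continuous_on {0..} f"
      using f by (intro continuous_on_vector_derivative) auto
    then show "continuous_on {0..T} f" by (rule continuous_on_subset) auto
    show "continuous_on {0..T} (\<lambda>t. - k * exp (- a * t))" by (intro continuous_intros)
    show "(f has_vector_derivative f' x) (at x)" if "0 < x" "x < T" for x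
      using f[of x] that at_within_interior[of x "{0..}"] by (simp add: interior_real_atLeast)
    show "((\<lambda>t. - k * exp (- a * t)) has_vector_derivative k * a * exp (- a * x)) (at x)" for x
      by (auto intro!: derivative_eq_intros simp flip: has_real_derivative_iff_has_vector_derivative)
    show "norm (f' x) \<le> k * a * exp (- a * x)" if "0 < x" "x < T" for x
      using bnd[of x] that by simp
  qed
  then show ?thesis by (simp add: algebra_simps)
qed simp

text \<open>The condition involving the maximum \<lambda>0 is split into its three entries:
  \<open>cond_W\<close>, \<open>cond_A\<close> and \<open>cond_b\<close> each limit the total
  movement of one parameter, and \<open>cond_Z\<close> that of the equilibrium.\<close>

locale gradient_flow =
  fixes X :: "real^'d^'N" and y :: "real^'N"
    and W :: "real \<Rightarrow> real^'m^'d" and A :: "real \<Rightarrow> real^'m^'m" and b :: "real \<Rightarrow> real^'m"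
    and \<gamma> C1 C2 C3 l1 l2 l3 g \<alpha> :: real
  assumes C_pos: "C1 > 0" "C2 > 0" "C3 > 0"
    and flowW: "\<And>t. t \<ge> 0 \<Longrightarrow> ((\<lambda>s. vecm (W s)) has_vector_derivative
                 - gradW \<gamma> X y (W t) (A t) (b t)) (at t within {0..})"
    and flowA: "\<And>t. t \<ge> 0 \<Longrightarrow> ((\<lambda>s. vecm (A s)) has_vector_derivative
                 - gradA \<gamma> X y (W t) (A t) (b t)) (at t within {0..})"
    and flowb: "\<And>t. t \<ge> 0 \<Longrightarrow> (b has_vector_derivative
                 - gradb \<gamma> X y (W t) (A t) (b t)) (at t within {0..})"
    and gamma_pos: "\<gamma> > 0"
    and l1: "l1 = spec_norm (W 0) + C1" and l2: "l2 = spec_norm (A 0) + C2" and l3: "l3 = norm (b 0) + C3"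
    and g: "g = \<gamma> * l2" "g < 1"
    and \<alpha>: "\<alpha> = sigma_min (Zeq \<gamma> X (W 0) (A 0))"
    and cond_W: "4 / (1 - g) * (l3 / C1) * norm X * norm (yhat \<gamma> X (W 0) (A 0) (b 0) - y) \<le> \<alpha>\<^sup>2"
    and cond_A: "4 / (1 - g) * (g * l1 * l3 / ((1 - g) * C2 * l2)) * norm X
      * norm (yhat \<gamma> X (W 0) (A 0) (b 0) - y) \<le> \<alpha>\<^sup>2"
    and cond_b: "4 / (1 - g) * (l1 / C3) * norm X * norm (yhat \<gamma> X (W 0) (A 0) (b 0) - y) \<le> \<alpha>\<^sup>2"
    and cond_Z: "(1 + g\<^sup>2 / (1 - g)\<^sup>2 * (l1\<^sup>2 / l2\<^sup>2)) * (8 * l3 / (1 - g)\<^sup>2) * (norm X)\<^sup>2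
      * norm (yhat \<gamma> X (W 0) (A 0) (b 0) - y) \<le> \<alpha> ^ 3"
begin

abbreviation "Z s \<equiv> Zeq \<gamma> X (W s) (A s)"
abbreviation "res s \<equiv> norm (yhat \<gamma> X (W s) (A s) (b s) - y)"
abbreviation "los s \<equiv> loss \<gamma> X y (W s) (A s) (b s)"
abbreviation "gW s \<equiv> gradW \<gamma> X y (W s) (A s) (b s)"
abbreviation "gA s \<equiv> gradA \<gamma> X y (W s) (A s) (b s)"
abbreviation "gb s \<equiv> gradb \<gamma> X y (W s) (A s) (b s)"

definition "\<rho> = norm X * res 0"
text \<open>For \<alpha> nonzero this is \<open>\<rho> / a\<close>, the integral over all times of
  the bound \<open>\<rho> * exp (- a * t)\<close> for \<open>norm X * res t\<close>. For \<alpha> =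
  0 division by zero makes it 0.\<close>

definition "\<kappa> = 4 * \<rho> / \<alpha>\<^sup>2"
text \<open>Half the decay rate of the loss, because the residual behaves like its square
  root.\<close>

definition "a = \<alpha>\<^sup>2 / 4"
definition "H s = (\<gamma> * norm (Z 0) * norm (A s - A 0) + norm X * norm (W s - W 0)) / (1 - g)"

text \<open>The invariant of the bootstrap argument. \<open>H s\<close> dominates the displacement of \<open>Z\<close>, but unlike
  \<open>Z\<close> it is visibly continuous; strict inequalities make the invariant an open condition. If
  \<open>\<alpha> = 0\<close> the gradient vanishes, and nothing has to be known about \<open>Z\<close>.\<close>

definition "inv_at s \<longleftrightarrow> norm (W s - W 0) < C1 \<and> norm (A s - A 0) < C2 \<and> norm (b s - b 0) < C3
  \<and> (\<alpha> = 0 \<or> H s < \<alpha> / 2)"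

lemma pos: "l1 > 0" "l2 > 0" "l3 > 0" "g > 0" "1 - g > 0" "\<alpha> \<ge> 0" "\<rho> \<ge> 0" "\<kappa> \<ge> 0" "a \<ge> 0"
proof -
  show *: "l1 > 0" "l2 > 0" "l3 > 0"
    unfolding l1 l2 l3 using C_pos spec_norm_nonneg by (auto intro: add_nonneg_pos)
  show "g > 0" "1 - g > 0" using g gamma_pos * by auto
  show "\<alpha> \<ge> 0" unfolding \<alpha> by (rule sigma_min_nonneg)
  show "\<rho> \<ge> 0" "\<kappa> \<ge> 0" "a \<ge> 0" by (simp_all add: \<rho>_def \<kappa>_def a_def)
qed

lemma flowW': "t \<ge> 0 \<Longrightarrow> (W has_vector_derivative unvecm (- gW t)) (at t within {0..})"
  using bounded_linear.has_vector_derivative[OF bounded_linear_unvecm flowW[of t]] by simp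

lemma flowA': "t \<ge> 0 \<Longrightarrow> (A has_vector_derivative unvecm (- gA t)) (at t within {0..})"
  using bounded_linear.has_vector_derivative[OF bounded_linear_unvecm flowA[of t]] by simp

lemma at_right_of_flow:
  "t \<ge> 0 \<Longrightarrow> (f has_vector_derivative f') (at t within {0..}) \<Longrightarrow> (f has_vector_derivative f') (at_right t)"
  by (rule has_vector_derivative_within_subset) auto

lemma continuous_flow: "continuous_on {0..} W" "continuous_on {0..} A" "continuous_on {0..} b"
  by (rule continuous_on_vector_derivative, use flowW' flowA' flowb in auto)+

lemma inv_at_0: "inv_at 0"
  using C_pos pos(6) by (auto simp: inv_at_def H_def)

section \<open>Consequences of the invariant: bounds and decay\<close>

lemma spec_A_if_near:
  assumes "norm (A s - A 0) < C2"
  shows "\<gamma> * spec_norm (A s) \<le> g"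
  using spec_norm_diff_le[of "A s" "A 0"] assms gamma_pos unfolding g(1) l2 by simp

lemma displacement_Z:
  assumes "norm (A s - A 0) < C2"
  shows "norm (Z s - Z 0) \<le> H s"
  using norm_Zeq_diff_le[of \<gamma> g "A 0" "A s" X "W s" "W 0"] spec_A_if_near[OF assms] spec_A_if_near[of 0]
    gamma_pos pos C_pos unfolding H_def by (simp add: pos_le_divide_eq mult.commute)

lemma inv_atD:
  assumes "inv_at s"
  shows "spec_norm (W s) \<le> l1" "spec_norm (A s) \<le> l2" "norm (b s) \<le> l3" "\<gamma> * spec_norm (A s) \<le> g"
    "\<alpha> / 2 \<le> sigma_min (Z s)" "norm (Z s) \<le> norm X * l1 / (1 - g)"
proof -
  show l1': "spec_norm (W s) \<le> l1"
    using assms spec_norm_diff_le[of "W s" "W 0"] unfolding inv_at_def l1 by simp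
  show "spec_norm (A s) \<le> l2"
    using assms spec_norm_diff_le[of "A s" "A 0"] unfolding inv_at_def l2 by simp
  show "norm (b s) \<le> l3"
    using assms norm_triangle_ineq2[of "b s" "b 0"] unfolding inv_at_def l3 by simp
  show gA: "\<gamma> * spec_norm (A s) \<le> g"
    using assms spec_A_if_near unfolding inv_at_def by blast
  show "\<alpha> / 2 \<le> sigma_min (Z s)"
  proof (cases "\<alpha> = 0")
    case False
    then have "norm (Z 0 - Z s) < \<alpha> / 2"
      using assms displacement_Z[of s] unfolding inv_at_def by (simp add: norm_minus_commute)
    then show ?thesis using sigma_min_diff_le[of "Z 0" "Z s"] \<alpha> by simp
  qed (simp add: sigma_min_nonneg)
  have "(1 - g) * norm (Z s) \<le> norm X * spec_norm (W s)"
    using norm_Zeq_le[OF _ gA] gamma_pos pos by simp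
  also have "\<dots> \<le> norm X * l1" using l1' by (rule mult_left_mono) simp
  finally show "norm (Z s) \<le> norm X * l1 / (1 - g)"
    using pos by (simp add: pos_le_divide_eq mult.commute)
qed

lemma loss_decay:
  assumes T: "0 \<le> T" and P: "\<And>s. 0 \<le> s \<Longrightarrow> s \<le> T \<Longrightarrow> inv_at s"
  shows "los T \<le> exp (- \<alpha>\<^sup>2 * T / 2) * los 0"
proof -
  define k where "k = \<alpha>\<^sup>2 / 2"
  let ?S = "kinks (\<lambda>s. preact \<gamma> X (W s) (A s)) \<union> kinks (\<lambda>s. X ** W s)"
  have sub: "{0..T} \<subseteq> {0..}" by auto
  have cont: "continuous_on {0..T} Z"
    unfolding continuous_on_def
  proof
    fix t assume t: "t \<in> {0..T}"
    show "(Z \<longlongrightarrow> Z t) (at t within {0..T})"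
    proof (rule tendsto_Zeq[of _ g])
      show "(W \<longlongrightarrow> W t) (at t within {0..T})" "(A \<longlongrightarrow> A t) (at t within {0..T})"
        using continuous_on_subset[OF continuous_flow(1) sub] continuous_on_subset[OF continuous_flow(2) sub] t
        by (auto simp: continuous_on_def)
      show "eventually (\<lambda>s. \<gamma> * spec_norm (A s) \<le> g) (at t within {0..T})"
        using P inv_atD(4) by (auto simp: eventually_at_filter)
    qed (use P inv_atD(4) t gamma_pos g in auto)
  qed
  \<comment> \<open>With the integrating factor, decay becomes monotonicity, which the right
    derivatives outside the countable set \<open>?S\<close> suffice to prove.\<close>
  have "exp (k * T) * los T \<le> exp (k * 0) * los 0"
  proof (rule right_derivative_nonpos_imp_le[OF T, where S = ?S and f = "\<lambda>t. exp (k * t) * los t"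
        and f' = "\<lambda>t. exp (k * t) * (k * los t - ((norm (gW t))\<^sup>2 + (norm (gA t))\<^sup>2 + (norm (gb t))\<^sup>2))"])
    show "continuous_on {0..T} (\<lambda>t. exp (k * t) * los t)"
      unfolding loss_def yhat_def
      by (intro continuous_intros bounded_bilinear.continuous_on[OF bounded_bilinear_matrix_vector_mult]
          cont continuous_on_subset[OF continuous_flow(3) sub])
    show "countable ?S" by (simp add: countable_kinks)
    fix t assume t: "0 \<le> t" "t < T"
    then have Pt: "inv_at t" using P by simp
    \<comment> \<open>Because of the factor 1/2 in the loss, the rate \<open>k\<close> makes this
      exactly the square of the lower bound \<open>\<alpha> / 2 * res t\<close> for the
      \<open>b\<close>-gradient.\<close>
    have "los t * k = (\<alpha> / 2 * res t)\<^sup>2"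
      by (simp add: loss_def k_def power_mult_distrib power_divide)
    also have "\<dots> \<le> (norm (gb t))\<^sup>2"
    proof (intro power_mono)
      have "\<alpha> / 2 * res t \<le> sigma_min (Z t) * res t"
        using inv_atD(5)[OF Pt] by (rule mult_right_mono) simp
      also have "\<dots> \<le> norm (gb t)" unfolding gradb_def by (rule sigma_min_mult_norm_le)
      finally show "\<alpha> / 2 * res t \<le> norm (gb t)" .
    qed (use pos in simp)
    finally have "k * los t - ((norm (gW t))\<^sup>2 + (norm (gA t))\<^sup>2 + (norm (gb t))\<^sup>2) \<le> 0"
      by (simp add: mult.commute add_increasing)
    then show "exp (k * t) * (k * los t - ((norm (gW t))\<^sup>2 + (norm (gA t))\<^sup>2 + (norm (gb t))\<^sup>2)) \<le> 0"
      by (simp add: mult_le_0_iff)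
    assume "t \<notin> ?S"
    have ev: "eventually (\<lambda>s. \<gamma> * spec_norm (A s) \<le> g) (at_right t)"
      unfolding eventually_at_right_field using t P inv_atD(4) by (intro exI[of _ T]) auto
    have "(los has_vector_derivative (gW t \<bullet> vecm (unvecm (- gW t)) + gA t \<bullet> vecm (unvecm (- gA t)) + gb t \<bullet> (- gb t)))
        (at_right t)"
      by (rule loss_has_right_derivative[of _ g])
        (use \<open>t \<notin> ?S\<close> ev inv_atD(4)[OF Pt] gamma_pos g(2) at_right_of_flow[OF t(1) flowW'[OF t(1)]]
          at_right_of_flow[OF t(1) flowA'[OF t(1)]] at_right_of_flow[OF t(1) flowb[OF t(1)]] in auto)
    then have los': "(los has_vector_derivative - ((norm (gW t))\<^sup>2 + (norm (gA t))\<^sup>2 + (norm (gb t))\<^sup>2)) (at_right t)"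
      by (simp add: power2_norm_eq_inner)
    show "((\<lambda>t. exp (k * t) * los t) has_vector_derivative
        exp (k * t) * (k * los t - ((norm (gW t))\<^sup>2 + (norm (gA t))\<^sup>2 + (norm (gb t))\<^sup>2))) (at_right t)"
      using los' unfolding has_real_derivative_iff_has_vector_derivative[symmetric]
      by (auto intro!: derivative_eq_intros simp: algebra_simps)
  qed
  then have "exp (- (k * T)) * (exp (k * T) * los T) \<le> exp (- (k * T)) * los 0" by simp
  then show ?thesis by (simp add: k_def flip: mult.assoc exp_add)
qed

lemma residual_decay:
  assumes "0 \<le> T" "\<And>s. 0 \<le> s \<Longrightarrow> s \<le> T \<Longrightarrow> inv_at s"
  shows "res T \<le> exp (- a * T) * res 0"
proof -
  have "(res T)\<^sup>2 \<le> exp (- \<alpha>\<^sup>2 * T / 2) * (res 0)\<^sup>2"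
    using loss_decay[OF assms] by (simp add: loss_def)
  also have "exp (- \<alpha>\<^sup>2 * T / 2) = (exp (- a * T))\<^sup>2"
    by (simp add: a_def power2_eq_square flip: exp_add)
  finally have "(res T)\<^sup>2 \<le> (exp (- a * T) * res 0)\<^sup>2" by (simp add: power_mult_distrib)
  then show ?thesis by (rule power2_le_imp_le) simp
qed

text \<open>All three bounds have the shape \<open>c * (norm X * res t)\<close>, so a single decay
  estimate integrates them. The square of \<open>1 - g\<close> for \<open>A\<close> comes from the
  inverse of \<open>Q\<close> together with the bound on \<open>Z\<close>.\<close>

lemma norm_gradients_le:
  assumes "inv_at t"
  shows "norm (gW t) \<le> l3 / (1 - g) * (norm X * res t)"
    and "norm (gA t) \<le> \<gamma> * l1 * l3 / (1 - g)\<^sup>2 * (norm X * res t)"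
    and "norm (gb t) \<le> l1 / (1 - g) * (norm X * res t)"
proof -
  note D = inv_atD[OF assms]
  have m: "norm (b t) * res t \<le> l3 * res t" using D(3) by (rule mult_right_mono) simp
  have m': "1 / (1 - g) * (norm (b t) * res t) \<le> 1 / (1 - g) * (l3 * res t)"
    using m pos by (intro mult_left_mono) auto
  have "norm (gW t) \<le> norm X * (1 / (1 - g) * (norm (b t) * res t))"
    using D(4) gamma_pos g by (intro norm_gradW_le) auto
  also have "\<dots> \<le> norm X * (1 / (1 - g) * (l3 * res t))"
    using m' by (rule mult_left_mono) simp
  finally show "norm (gW t) \<le> l3 / (1 - g) * (norm X * res t)" by (simp add: algebra_simps)
  have "norm (gA t) \<le> \<gamma> * norm (Z t) * (1 / (1 - g) * (norm (b t) * res t))"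
    using D(4) gamma_pos g by (intro norm_gradA_le) auto
  also have "\<dots> \<le> \<gamma> * (norm X * l1 / (1 - g)) * (1 / (1 - g) * (l3 * res t))"
    by (rule mult_mono[OF mult_left_mono[OF D(6)] m']) (use gamma_pos pos in auto)
  finally show "norm (gA t) \<le> \<gamma> * l1 * l3 / (1 - g)\<^sup>2 * (norm X * res t)"
    by (simp add: power2_eq_square algebra_simps)
  have "norm (gb t) \<le> norm (Z t) * res t" by (rule norm_gradb_le)
  also have "\<dots> \<le> norm X * l1 / (1 - g) * res t" using D(6) by (rule mult_right_mono) simp
  finally show "norm (gb t) \<le> l1 / (1 - g) * (norm X * res t)" by (simp add: algebra_simps)
qed

text \<open>In the degenerate case the cubic condition, whose coefficient is positive, forces
  \<open>norm X\<close> or the initial residual to vanish. This keeps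
  \<open>\<kappa> * a = \<rho>\<close> true despite the division by zero in \<kappa>.\<close>

lemma \<rho>_eq_0: "\<alpha> = 0 \<Longrightarrow> \<rho> = 0"
proof -
  assume "\<alpha> = 0"
  define K where "K = (1 + g\<^sup>2 / (1 - g)\<^sup>2 * (l1\<^sup>2 / l2\<^sup>2)) * (8 * l3 / (1 - g)\<^sup>2)"
  have "K > 0" unfolding K_def using pos by (intro mult_pos_pos add_pos_nonneg) auto
  moreover have "K * ((norm X)\<^sup>2 * res 0) \<le> 0"
    using cond_Z \<open>\<alpha> = 0\<close> by (simp add: K_def mult.assoc)
  ultimately have "(norm X)\<^sup>2 * res 0 \<le> 0" by (simp add: mult_le_0_iff)
  then show "\<rho> = 0" unfolding \<rho>_def by (auto simp: mult_le_0_iff)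
qed

lemma \<kappa>_mult_a: "\<kappa> * a = \<rho>"
  unfolding \<kappa>_def a_def using \<rho>_eq_0 by (cases "\<alpha> = 0") simp_all

lemma \<kappa>_le:
  assumes "4 * c * \<rho> \<le> C * \<alpha>\<^sup>2" "0 \<le> C"
  shows "c * \<kappa> \<le> C"
proof (cases "\<alpha> = 0")
  case False
  then have "c * \<kappa> = 4 * c * \<rho> / \<alpha>\<^sup>2" by (simp add: \<kappa>_def)
  then show ?thesis using assms False by (simp add: pos_divide_le_eq)
next
  case True
  then have "\<kappa> = 0" unfolding \<kappa>_def by simp
  then show ?thesis using assms by simp
qed

text \<open>A gradient coefficient times \<kappa> bounds the total displacement of that parameter;
  these are the conditions on \<open>\<alpha>\<^sup>2\<close> solved for it.\<close>

lemma budget: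
  "l3 / (1 - g) * \<kappa> \<le> C1" "\<gamma> * l1 * l3 / (1 - g)\<^sup>2 * \<kappa> \<le> C2" "l1 / (1 - g) * \<kappa> \<le> C3"
proof -
  have "4 * (l3 / (1 - g)) * \<rho> = C1 * (4 / (1 - g) * (l3 / C1) * norm X * res 0)"
    using C_pos pos by (simp add: \<rho>_def)
  also have "\<dots> \<le> C1 * \<alpha>\<^sup>2" using cond_W C_pos by (intro mult_left_mono) auto
  finally show "l3 / (1 - g) * \<kappa> \<le> C1" using C_pos by (intro \<kappa>_le) auto
  \<comment> \<open>One factor \<open>g\<close> is written as \<open>\<gamma> * l2\<close>, so that
    \<open>l2\<close> cancels.\<close>
  have "4 * (\<gamma> * l1 * l3 / (1 - g)\<^sup>2) * \<rho>
      = C2 * (4 / (1 - g) * (g * l1 * l3 / ((1 - g) * C2 * l2)) * norm X * res 0)"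
    using C_pos pos by (simp add: \<rho>_def g(1) power2_eq_square)
  also have "\<dots> \<le> C2 * \<alpha>\<^sup>2" using cond_A C_pos by (intro mult_left_mono) auto
  finally show "\<gamma> * l1 * l3 / (1 - g)\<^sup>2 * \<kappa> \<le> C2" using C_pos by (intro \<kappa>_le) auto
  have "4 * (l1 / (1 - g)) * \<rho> = C3 * (4 / (1 - g) * (l1 / C3) * norm X * res 0)"
    using C_pos pos by (simp add: \<rho>_def)
  also have "\<dots> \<le> C3 * \<alpha>\<^sup>2" using cond_b C_pos by (intro mult_left_mono) auto
  finally show "l1 / (1 - g) * \<kappa> \<le> C3" using C_pos by (intro \<kappa>_le) auto
qed

text \<open>The left side is \<open>H\<close> with the displacements of \<open>A\<close> and
  \<open>W\<close> replaced by their total bounds.\<close>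

lemma budget_Z:
  "(\<gamma> * norm (Z 0) * (\<gamma> * l1 * l3 / (1 - g)\<^sup>2 * \<kappa>) + norm X * (l3 / (1 - g) * \<kappa>)) / (1 - g) \<le> \<alpha> / 2"
proof -
  define c where "c = (1 + \<gamma>\<^sup>2 * l1\<^sup>2 / (1 - g)\<^sup>2) * (l3 / (1 - g)\<^sup>2) * norm X"
  have "\<gamma> * norm (Z 0) * (\<gamma> * l1 * l3 / (1 - g)\<^sup>2 * \<kappa>)
      \<le> \<gamma> * (norm X * l1 / (1 - g)) * (\<gamma> * l1 * l3 / (1 - g)\<^sup>2 * \<kappa>)"
    using inv_atD(6)[OF inv_at_0] gamma_pos pos by (intro mult_mono) auto
  then have "(\<gamma> * norm (Z 0) * (\<gamma> * l1 * l3 / (1 - g)\<^sup>2 * \<kappa>) + norm X * (l3 / (1 - g) * \<kappa>)) / (1 - g)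
      \<le> (\<gamma> * (norm X * l1 / (1 - g)) * (\<gamma> * l1 * l3 / (1 - g)\<^sup>2 * \<kappa>) + norm X * (l3 / (1 - g) * \<kappa>)) / (1 - g)"
    using pos by (intro divide_right_mono) auto
  also have "\<dots> = c * \<kappa>"
  proof -
    have "(\<gamma> * (norm X * l1 / q) * (\<gamma> * l1 * l3 / q\<^sup>2 * \<kappa>) + norm X * (l3 / q * \<kappa>)) / q
        = (1 + \<gamma>\<^sup>2 * l1\<^sup>2 / q\<^sup>2) * (l3 / q\<^sup>2) * norm X * \<kappa>" if "q > 0" for q
      using that by (simp add: field_simps power2_eq_square)
    then show ?thesis unfolding c_def using pos(5) by blast
  qed
  also have "\<dots> \<le> \<alpha> / 2"
  proof (rule \<kappa>_le)
    have "g\<^sup>2 / (1 - g)\<^sup>2 * (l1\<^sup>2 / l2\<^sup>2) = \<gamma>\<^sup>2 * l1\<^sup>2 / (1 - g)\<^sup>2"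
      using pos(2) unfolding g(1) by (simp add: power_mult_distrib)
    then have "(1 + \<gamma>\<^sup>2 * l1\<^sup>2 / (1 - g)\<^sup>2) * (8 * l3 / (1 - g)\<^sup>2) * (norm X)\<^sup>2 * res 0 \<le> \<alpha> ^ 3"
      using cond_Z by simp
    moreover have "8 * c * \<rho> = (1 + \<gamma>\<^sup>2 * l1\<^sup>2 / (1 - g)\<^sup>2) * (8 * l3 / (1 - g)\<^sup>2) * (norm X)\<^sup>2 * res 0"
      by (simp add: c_def \<rho>_def power2_eq_square)
    \<comment> \<open>The constant 8 of the cubic condition is the 4 in \<kappa> times the 2 in
      \<open>\<alpha> / 2\<close>.\<close>
    ultimately show "4 * c * \<rho> \<le> \<alpha> / 2 * \<alpha>\<^sup>2" by (simp add: power2_eq_square power3_eq_cube)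
  qed (use pos in simp)
  finally show ?thesis .
qed

text \<open>The gradients at times before \<open>T\<close> already determine the displacement at
  \<open>T\<close>. The budgets are non-strict, but by time \<open>T\<close> only the fraction
  \<open>e < 1\<close> of them can have been used, which restores the strict inequalities of the
  invariant.\<close>

lemma inv_at_reached:
  assumes T: "0 \<le> T" and P: "\<And>s. 0 \<le> s \<Longrightarrow> s < T \<Longrightarrow> inv_at s"
  shows "inv_at T"
proof -
  define e where "e = 1 - exp (- a * T)"
  have e: "0 \<le> e" "e < 1" unfolding e_def using pos T by auto
  have res: "c * (norm X * res t) \<le> c * \<kappa> * a * exp (- a * t)" if "0 \<le> t" "t < T" "0 \<le> c" for c t
  proof -
    have "norm X * res t \<le> norm X * (exp (- a * t) * res 0)"
      using that P by (intro mult_left_mono residual_decay) auto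
    also have "\<dots> = \<kappa> * a * exp (- a * t)" unfolding \<kappa>_mult_a by (simp add: \<rho>_def)
    finally show ?thesis using that(3) by (simp add: mult_left_mono mult.assoc)
  qed
  have norm_unvecm: "norm (unvecm (- v)) = norm v" for v :: "real^('x::finite \<times> 'y::finite)"
    using norm_vecm[of "unvecm (- v)"] by simp
  have W: "norm (W T - W 0) \<le> l3 / (1 - g) * \<kappa> * e"
    unfolding e_def
  proof (rule exponential_decay_displacement[OF T flowW'])
    fix t assume t: "0 \<le> t" "t < T"
    show "norm (unvecm (- gW t)) \<le> l3 / (1 - g) * \<kappa> * a * exp (- a * t)"
      unfolding norm_unvecm using norm_gradients_le(1)[OF P[OF t]] res[OF t, of "l3 / (1 - g)"] pos by simp
  qed
  have A: "norm (A T - A 0) \<le> \<gamma> * l1 * l3 / (1 - g)\<^sup>2 * \<kappa> * e"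
    unfolding e_def
  proof (rule exponential_decay_displacement[OF T flowA'])
    fix t assume t: "0 \<le> t" "t < T"
    show "norm (unvecm (- gA t)) \<le> \<gamma> * l1 * l3 / (1 - g)\<^sup>2 * \<kappa> * a * exp (- a * t)"
      unfolding norm_unvecm
      using norm_gradients_le(2)[OF P[OF t]] res[OF t, of "\<gamma> * l1 * l3 / (1 - g)\<^sup>2"] pos gamma_pos by simp
  qed
  have b: "norm (b T - b 0) \<le> l1 / (1 - g) * \<kappa> * e"
    unfolding e_def
  proof (rule exponential_decay_displacement[OF T flowb])
    fix t assume t: "0 \<le> t" "t < T"
    show "norm (- gb t) \<le> l1 / (1 - g) * \<kappa> * a * exp (- a * t)"
      using norm_gradients_le(3)[OF P[OF t]] res[OF t, of "l1 / (1 - g)"] pos by simp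
  qed
  have less: "x < C" if "x \<le> c * e" "c \<le> C" "C > 0" for x c C :: real
  proof -
    have "x \<le> C * e" using that mult_right_mono[OF that(2) e(1)] by simp
    also have "\<dots> < C" using e that(3) by simp
    finally show ?thesis .
  qed
  \<comment> \<open>\<open>H\<close> is increasing and linear in the two displacements, so the
    common factor \<open>e\<close> can be pulled out.\<close>
  have "H T < \<alpha> / 2" if "\<alpha> \<noteq> 0"
  proof (rule less)
    have "H T \<le> (\<gamma> * norm (Z 0) * (\<gamma> * l1 * l3 / (1 - g)\<^sup>2 * \<kappa> * e) + norm X * (l3 / (1 - g) * \<kappa> * e)) / (1 - g)"
      unfolding H_def using W A pos gamma_pos by (intro divide_right_mono add_mono mult_left_mono) auto
    then show "H T \<le> (\<gamma> * norm (Z 0) * (\<gamma> * l1 * l3 / (1 - g)\<^sup>2 * \<kappa>) + norm X * (l3 / (1 - g) * \<kappa>)) / (1 - g) * e"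
      by (simp add: algebra_simps add_divide_distrib)
  qed (use budget_Z pos that in auto)
  then show ?thesis
    unfolding inv_at_def
    using less[OF W budget(1) C_pos(1)] less[OF A budget(2) C_pos(2)] less[OF b budget(3) C_pos(3)] by blast
qed

lemma inv_at_open:
  assumes T: "0 \<le> T" and P: "inv_at T"
  shows "eventually inv_at (at_right T)"
proof -
  have lim: "(W \<longlongrightarrow> W T) (at_right T)" "(A \<longlongrightarrow> A T) (at_right T)" "(b \<longlongrightarrow> b T) (at_right T)"
    using at_right_of_flow[OF T] flowW'[OF T] flowA'[OF T] flowb[OF T]
    by (auto intro: has_vector_derivative_at_right_tendsto)
  have "((\<lambda>s. norm (W s - W 0)) \<longlongrightarrow> norm (W T - W 0)) (at_right T)"
    "((\<lambda>s. norm (A s - A 0)) \<longlongrightarrow> norm (A T - A 0)) (at_right T)"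
    "((\<lambda>s. norm (b s - b 0)) \<longlongrightarrow> norm (b T - b 0)) (at_right T)"
    "(H \<longlongrightarrow> H T) (at_right T)"
    unfolding H_def[abs_def] using pos by (auto intro!: tendsto_intros lim)
  note ev = this[THEN order_tendstoD(2)]
  have "eventually (\<lambda>s. norm (W s - W 0) < C1) (at_right T)"
    "eventually (\<lambda>s. norm (A s - A 0) < C2) (at_right T)"
    "eventually (\<lambda>s. norm (b s - b 0) < C3) (at_right T)"
    using P ev(1-3) unfolding inv_at_def by blast+
  moreover have "eventually (\<lambda>s. \<alpha> = 0 \<or> H s < \<alpha> / 2) (at_right T)"
    using P ev(4)[of "\<alpha> / 2"] unfolding inv_at_def by (cases "\<alpha> = 0") auto
  ultimately show ?thesis by eventually_elim (simp add: inv_at_def)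
qed

lemma inv_at_all: "0 \<le> t \<Longrightarrow> inv_at t"
  by (rule continuous_induction_nonneg[where P = inv_at]) (use inv_at_reached inv_at_open in auto)

end

theorem theorem1:
  fixes X :: "real^'d::finite^'N::finite" and y :: "real^'N"
    and W :: "real \<Rightarrow> real^'m::finite^'d" and A :: "real \<Rightarrow> real^'m^'m" and b :: "real \<Rightarrow> real^'m"
    and \<gamma> C\<^sub>1 C\<^sub>2 C\<^sub>3 :: real
  assumes C_pos: "C\<^sub>1 > 0" "C\<^sub>2 > 0" "C\<^sub>3 > 0"
    and flowW: "\<And>t. t \<ge> 0 \<Longrightarrow> ((\<lambda>s. vecm (W s)) has_vector_derivative
                 - gradW \<gamma> X y (W t) (A t) (b t)) (at t within {0..})"
    and flowA: "\<And>t. t \<ge> 0 \<Longrightarrow> ((\<lambda>s. vecm (A s)) has_vector_derivative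
                 - gradA \<gamma> X y (W t) (A t) (b t)) (at t within {0..})"
    and flowb: "\<And>t. t \<ge> 0 \<Longrightarrow> (b has_vector_derivative
                 - gradb \<gamma> X y (W t) (A t) (b t)) (at t within {0..})"
    and gamma_pos: "\<gamma> > 0"
    and gamma0: "\<gamma> * (spec_norm (A 0) + C\<^sub>2) < 1"
    and cond1: "let a0 = sigma_min (Zeq \<gamma> X (W 0) (A 0));
                    l1 = spec_norm (W 0) + C\<^sub>1; l2 = spec_norm (A 0) + C\<^sub>2; l3 = norm (b 0) + C\<^sub>3;
                    g0 = \<gamma> * l2;
                    l0 = Max {l1 / C\<^sub>3, g0 * l1 * l3 / ((1 - g0) * C\<^sub>2 * l2), l3 / C\<^sub>1}
                in a0\<^sup>2 \<ge> 4 / (1 - g0) * l0 * frob_norm X * norm (yhat \<gamma> X (W 0) (A 0) (b 0) - y)"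
    and cond2: "let a0 = sigma_min (Zeq \<gamma> X (W 0) (A 0));
                    l1 = spec_norm (W 0) + C\<^sub>1; l2 = spec_norm (A 0) + C\<^sub>2; l3 = norm (b 0) + C\<^sub>3;
                    g0 = \<gamma> * l2
                in a0 ^ 3 \<ge> (1 + g0\<^sup>2 / (1 - g0)\<^sup>2 * (l1\<^sup>2 / l2\<^sup>2)) * (8 * l3 / (1 - g0)\<^sup>2)
                      * (frob_norm X)\<^sup>2 * norm (yhat \<gamma> X (W 0) (A 0) (b 0) - y)"
  shows "\<forall>t \<ge> 0.
           spec_norm (W t) \<le> spec_norm (W 0) + C\<^sub>1 \<and>
           spec_norm (A t) \<le> spec_norm (A 0) + C\<^sub>2 \<and>
           norm (b t) \<le> norm (b 0) + C\<^sub>3 \<and>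
           sigma_min (Zeq \<gamma> X (W t) (A t)) \<ge> sigma_min (Zeq \<gamma> X (W 0) (A 0)) / 2 \<and>
           loss \<gamma> X y (W t) (A t) (b t)
             \<le> exp (- (sigma_min (Zeq \<gamma> X (W 0) (A 0)))\<^sup>2 * t / 2) * loss \<gamma> X y (W 0) (A 0) (b 0)"
proof -
  define \<alpha> where "\<alpha> = sigma_min (Zeq \<gamma> X (W 0) (A 0))"
  define l1 where "l1 = spec_norm (W 0) + C\<^sub>1"
  define l2 where "l2 = spec_norm (A 0) + C\<^sub>2"
  define l3 where "l3 = norm (b 0) + C\<^sub>3"
  define g where "g = \<gamma> * l2"
  define r where "r = norm (yhat \<gamma> X (W 0) (A 0) (b 0) - y)"
  define M where "M = {l1 / C\<^sub>3, g * l1 * l3 / ((1 - g) * C\<^sub>2 * l2), l3 / C\<^sub>1}"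
  note defs = \<alpha>_def[symmetric] l1_def[symmetric] l2_def[symmetric] l3_def[symmetric]
    g_def[symmetric] r_def[symmetric] M_def[symmetric]
  have g: "g < 1" using gamma0 unfolding defs .
  have c1: "4 / (1 - g) * Max M * norm X * r \<le> \<alpha>\<^sup>2"
    using cond1 unfolding Let_def defs frob_norm_eq_norm .
  \<comment> \<open>The condition on the maximum gives the one on each entry, since the remaining
    factors are nonnegative.\<close>
  have c: "4 / (1 - g) * l * norm X * r \<le> \<alpha>\<^sup>2" if "l \<in> M" for l
  proof -
    have "l \<le> Max M" using that by (intro Max_ge) (simp_all add: M_def)
    then have "4 / (1 - g) * l * norm X * r \<le> 4 / (1 - g) * Max M * norm X * r"
      using g by (intro mult_right_mono mult_left_mono) (auto simp: r_def)
    with c1 show ?thesis by simp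
  qed
  interpret gradient_flow X y W A b \<gamma> "C\<^sub>1" "C\<^sub>2" "C\<^sub>3" l1 l2 l3 g \<alpha>
  proof unfold_locales
    show "4 / (1 - g) * (l3 / C\<^sub>1) * norm X * norm (yhat \<gamma> X (W 0) (A 0) (b 0) - y) \<le> \<alpha>\<^sup>2"
      "4 / (1 - g) * (g * l1 * l3 / ((1 - g) * C\<^sub>2 * l2)) * norm X
        * norm (yhat \<gamma> X (W 0) (A 0) (b 0) - y) \<le> \<alpha>\<^sup>2"
      "4 / (1 - g) * (l1 / C\<^sub>3) * norm X * norm (yhat \<gamma> X (W 0) (A 0) (b 0) - y) \<le> \<alpha>\<^sup>2"
      unfolding r_def[symmetric] by (intro c; simp add: M_def)+
    show "(1 + g\<^sup>2 / (1 - g)\<^sup>2 * (l1\<^sup>2 / l2\<^sup>2)) * (8 * l3 / (1 - g)\<^sup>2) * (norm X)\<^sup>2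
      * norm (yhat \<gamma> X (W 0) (A 0) (b 0) - y) \<le> \<alpha> ^ 3"
      using cond2 unfolding Let_def defs frob_norm_eq_norm .
  qed (fact C_pos flowW flowA flowb gamma_pos l1_def l2_def l3_def g_def g \<alpha>_def)+
  show ?thesis
    unfolding defs using inv_atD(1-3,5)[OF inv_at_all] loss_decay inv_at_all by simp
qed

end
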